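(* For a finite group $G$ with $|G|>2$ the following statements are equivalent: (1) $G$ is a $CD1$-group with $b_k=-a_k$; (2) $G$ is a $CD1$-group with $a_k=p^s$ for some positive integer $s$; (3) $G$ is a $2$-group of central type with $|Z(G)|=2$; with $\{1\}\cup b^G=Z(G)$ (i.e. when these conditions hold, $Z(G)=\{1\}\cup b^G$).
   Context: All groups are finite. Let $\mathrm{Irr}(G)=\{\chi_1,\dots,\chi_k\}$ be the set of complex irreducible characters of $G$, with $\chi_1=1_G$ and $\chi_1(1)=1\le\chi_2(1)\le\dots\le\chi_k(1)$. A group $G$ is a $CD1$-group if $|G|>2$ and two columns of its character table differ by exactly one entry, i.e. there are non-conjugate $a,b\in G$ and an index $j$ with $\chi_j(a)\ne\chi_j(b)$ and $\chi_i(a)=\chi_i(b)$ for all $i\ne j$. For a $CD1$-group it is known that one of the two conjugacy classes is $\{1\}$, that the other one, denoted $b^G$, is uniquely determined, that the two columns differ exactly in the row of $\chi_k$, and that $b$ has prime order, denoted $p$. Put $a_k=\chi_k(1)$ and $b_k=\chi_k(b)$. A group $G$ is of central type if there is $\chi\in\mathrm{Irr}(G)$ with $[G:Z(G)]=\chi(1)^2$. *)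

theory Defs
  imports
    "HOL-Algebra.Algebra"
    "Jordan_Normal_Form.VS_Connect"
begin

section \<open>Conjugacy classes and the centre\<close>

definition conj_class :: "('a, 'm) monoid_scheme \<Rightarrow> 'a \<Rightarrow> 'a set" where
  "conj_class G x =
     orbit G (\<lambda>g. \<lambda>h\<in>carrier G. g \<otimes>\<^bsub>G\<^esub> h \<otimes>\<^bsub>G\<^esub> inv\<^bsub>G\<^esub> g) x"

definition center :: "('a, 'm) monoid_scheme \<Rightarrow> 'a set" where
  "center G = {z \<in> carrier G. \<forall>g\<in>carrier G. z \<otimes>\<^bsub>G\<^esub> g = g \<otimes>\<^bsub>G\<^esub> z}"


section \<open>Complex irreducible characters\<close>

definition GL_complex :: "nat \<Rightarrow> complex mat monoid" where
  "GL_complex n = units_of (ring_mat TYPE(complex) n ())"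

definition mat_trace :: "'a::comm_monoid_add mat \<Rightarrow> 'a" where
  "mat_trace A = (\<Sum>i<dim_row A. A $$ (i, i))"

definition representation ::
    "('a, 'm) monoid_scheme \<Rightarrow> nat \<Rightarrow> ('a \<Rightarrow> complex mat) \<Rightarrow> bool" where
  "representation G n \<rho> \<longleftrightarrow> \<rho> \<in> hom G (GL_complex n)"

definition irreducible_representation ::
    "('a, 'm) monoid_scheme \<Rightarrow> nat \<Rightarrow> ('a \<Rightarrow> complex mat) \<Rightarrow> bool" where
  "irreducible_representation G n \<rho> \<longleftrightarrow>
     representation G n \<rho> \<and> 0 < n \<and>
     (\<forall>W. VectorSpace.subspace class_ring W (module_vec TYPE(complex) n) \<and>
          (\<forall>g\<in>carrier G. \<forall>w\<in>W. \<rho> g *\<^sub>v w \<in> W) \<longrightarrow>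
          W = {0\<^sub>v n} \<or> W = carrier_vec n)"

text \<open>
  Characters are extensional functions on the carrier (undefined outside of it), so that
  equality of characters means equality on the group.
\<close>
definition character ::
    "('a, 'm) monoid_scheme \<Rightarrow> ('a \<Rightarrow> complex mat) \<Rightarrow> 'a \<Rightarrow> complex" where
  "character G \<rho> = (\<lambda>g\<in>carrier G. mat_trace (\<rho> g))"

definition Irr :: "('a, 'm) monoid_scheme \<Rightarrow> ('a \<Rightarrow> complex) set" where
  "Irr G = {character G \<rho> | \<rho> n. irreducible_representation G n \<rho>}"

definition principal_character :: "('a, 'm) monoid_scheme \<Rightarrow> 'a \<Rightarrow> complex" where
  "principal_character G = (\<lambda>g\<in>carrier G. 1)"

text \<open>
  \<open>Irr G = {\<chi> 1, \<dots>, \<chi> k}\<close> without repetition, \<open>\<chi> 1 = 1\<^sub>G\<close>, with ascending degrees.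
  The degrees are positive integers seen as complex numbers, hence compared by real parts.
\<close>
definition irr_enumeration ::
    "('a, 'm) monoid_scheme \<Rightarrow> nat \<Rightarrow> (nat \<Rightarrow> 'a \<Rightarrow> complex) \<Rightarrow> bool" where
  "irr_enumeration G k \<chi> \<longleftrightarrow>
     bij_betw \<chi> {1..k} (Irr G) \<and>
     \<chi> 1 = principal_character G \<and>
     (\<forall>i j. 1 \<le> i \<and> i \<le> j \<and> j \<le> k \<longrightarrow> Re (\<chi> i \<one>\<^bsub>G\<^esub>) \<le> Re (\<chi> j \<one>\<^bsub>G\<^esub>))"


section \<open>CD1-groups\<close>

definition columns_differ_once :: "('a, 'm) monoid_scheme \<Rightarrow> 'a \<Rightarrow> 'a \<Rightarrow> bool" where
  "columns_differ_once G a b \<longleftrightarrow>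
     a \<in> carrier G \<and> b \<in> carrier G \<and> conj_class G a \<noteq> conj_class G b \<and>
     (\<exists>\<chi>\<in>Irr G. \<chi> a \<noteq> \<chi> b \<and> (\<forall>\<psi>\<in>Irr G - {\<chi>}. \<psi> a = \<psi> b))"

definition CD1_group :: "('a, 'm) monoid_scheme \<Rightarrow> bool" where
  "CD1_group G \<longleftrightarrow>
     group G \<and> finite (carrier G) \<and> 2 < Coset.order G \<and>
     (\<exists>a b. columns_differ_once G a b)"

text \<open>
  The class written \<open>b\<^sup>G\<close>: in a CD1-group one of the two classes involved is \<open>{1}\<close>, and this
  is the other one. For groups that are not CD1-groups the value is meaningless.
\<close>
definition CD1_class :: "('a, 'm) monoid_scheme \<Rightarrow> 'a set" where
  "CD1_class G =
     (THE C. \<exists>b. columns_differ_once G \<one>\<^bsub>G\<^esub> b \<and> C = conj_class G b)"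


section \<open>2-groups of central type\<close>

definition two_group :: "('a, 'm) monoid_scheme \<Rightarrow> bool" where
  "two_group G \<longleftrightarrow> (\<exists>m::nat. Coset.order G = 2 ^ m)"

definition central_type :: "('a, 'm) monoid_scheme \<Rightarrow> bool" where
  "central_type G \<longleftrightarrow>
     (\<exists>\<chi>\<in>Irr G. of_nat (card (rcosets\<^bsub>G\<^esub> (center G))) = (\<chi> \<one>\<^bsub>G\<^esub>)\<^sup>2)"

end

theory Submission
  imports
    Defs
    "Jordan_Normal_Form.Schur_Decomposition"
    "Jordan_Normal_Form.Spectral_Radius"
begin

text \<open>
  Everything rests on the identity
  \<open>(\<Sum>\<chi>\<in>Irr G. \<chi> 1 * \<chi> g) = (if g = 1 then |G| else 0)\<close> for the regular character
  (\<open>regular_character_identity\<close>). Schur's lemma gives the orthogonality of irreducible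
  characters. An invariant subspace makes a representation block triangular, and characters only
  see the diagonal blocks, so that every character is a sum of irreducible ones. Orthogonality then
  counts the constituents of the regular character. Two consequences are used throughout:
  irreducible characters separate conjugacy classes (\<open>characters_separate_conj_classes\<close>), and an
  element at which a character takes its degree acts trivially
  (\<open>representation_trivial_if_trace_eq_dim\<close>).

  Suppose two columns differ only in the row of \<open>\<chi>\<close>. If both belonged to elements
  other than \<open>1\<close>, subtracting the two regular identities would give
  \<open>\<chi> 1 * (\<chi> a - \<chi> b) = 0\<close>; so one of them is the column of \<open>1\<close>. Let \<open>N\<close> be the
  intersection of the kernels of the irreducible characters other than \<open>\<chi>\<close>, a normal subgroup
  that contains \<open>b\<close>, and let \<open>c = |N|\<close>. Since \<open>N\<close> is not in the kernel of \<open>\<chi>\<close>, the sum of the elements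
  of \<open>N\<close> acts as zero in the representation of \<open>\<chi>\<close>. As \<open>\<chi>\<close> is constant on the nonidentity elements
  of \<open>N\<close>, this yields
  \<open>(c - 1) * \<chi> b = - \<chi> 1\<close> and \<open>|G| * (c - 1) = (\<chi> 1)\<^sup>2 * c\<close>.
  In particular \<open>(\<chi> 1)\<^sup>2\<close> is at least half of \<open>|G|\<close>, which makes \<open>\<chi>\<close> the unique
  irreducible character of maximal degree when \<open>|G| > 2\<close> and makes the class of \<open>b\<close> unique.

  The condition \<open>\<chi> b = - \<chi> 1\<close> now says that \<open>c = 2\<close>. The condition on the degree also implies
  \<open>c = 2\<close>: the number \<open>c - 1\<close> divides the square of the degree, a power of the order of \<open>b\<close>,
  while the order of \<open>b\<close> divides \<open>c\<close>; hence \<open>c - 1\<close> is \<open>1\<close>.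
  If \<open>c = 2\<close>, then \<open>|G| = 2 * (\<chi> 1)\<^sup>2\<close>, the character vanishes off \<open>N = {1, b}\<close>, and therefore
  \<open>N\<close> is the centre. For an odd prime \<open>p\<close>, a Sylow \<open>p\<close>-subgroup \<open>P\<close> meets \<open>N\<close> trivially, so the
  restriction of \<open>\<chi>\<close> to \<open>P\<close> has sum \<open>\<chi> 1\<close>, which must be a multiple of \<open>|P|\<close>. Then \<open>|P|\<^sup>2\<close>
  divides \<open>|G|\<close>, which forces \<open>P\<close> to be trivial. Thus \<open>G\<close> is a 2-group, of
  central type because of \<open>\<chi>\<close>, and the degree is a power of \<open>2\<close>, the order of \<open>b\<close>.

  Conversely, let \<open>{1, z}\<close> be the centre and let \<open>\<psi> 1\<close> have square \<open>|G| / 2\<close>. Every irreducible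
  character takes the value plus or minus its degree at \<open>z\<close>, and the regular identity at \<open>z\<close> shows
  that the squares of the degrees of either sign add up to \<open>|G| / 2\<close>. So \<open>\<psi>\<close> is alone
  with its sign. The sign is minus, because the principal character has sign plus and \<open>|G| > 2\<close>;
  hence the columns of \<open>1\<close> and \<open>z\<close> differ exactly in the row of \<open>\<psi>\<close>.
\<close>

section \<open>Traces, subspaces and bases\<close>

lemma mat_trace_comm:
  fixes A B :: "'a::comm_semiring_0 mat"
  assumes A: "A \<in> carrier_mat n m" and B: "B \<in> carrier_mat m n"
  shows "mat_trace (A * B) = mat_trace (B * A)"
proof -
  have "mat_trace (A * B) = (\<Sum>i<n. \<Sum>j<m. A $$ (i,j) * B $$ (j,i))"
    using A B by (auto simp: mat_trace_def scalar_prod_def intro!: sum.cong)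
  also have "\<dots> = (\<Sum>j<m. \<Sum>i<n. A $$ (i,j) * B $$ (j,i))"
    by (rule sum.swap)
  also have "\<dots> = mat_trace (B * A)"
    using A B by (auto simp: mat_trace_def scalar_prod_def mult.commute intro!: sum.cong)
  finally show ?thesis .
qed

lemma mat_trace_one [simp]: "mat_trace (1\<^sub>m n :: 'a::semiring_1 mat) = of_nat n"
  by (simp add: mat_trace_def)

lemma mat_trace_smult:
  fixes A :: "'a::semiring_0 mat"
  assumes "A \<in> carrier_mat n n"
  shows "mat_trace (c \<cdot>\<^sub>m A) = c * mat_trace A"
  using assms by (simp add: mat_trace_def sum_distrib_left)

lemma mat_eq_if_mult_vec_eq:
  fixes A B :: "'a::semiring_1 mat"
  assumes A: "A \<in> carrier_mat n m" and B: "B \<in> carrier_mat n m"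
    and eq: "\<And>v. v \<in> carrier_vec m \<Longrightarrow> A *\<^sub>v v = B *\<^sub>v v"
  shows "A = B"
proof (rule eq_matI)
  fix i j assume "i < dim_row B" and "j < dim_col B"
  then have i: "i < n" and j: "j < m" using B by auto
  have "(A *\<^sub>v unit_vec m j) $ i = (B *\<^sub>v unit_vec m j) $ i"
    using eq by simp
  then show "A $$ (i,j) = B $$ (i,j)"
    using A B i j by simp
qed (use A B in auto)

lemma subspace_vec_iff:
  "VectorSpace.subspace class_ring W (module_vec TYPE(complex) n) \<longleftrightarrow>
     W \<subseteq> carrier_vec n \<and> 0\<^sub>v n \<in> W \<and> (\<forall>v\<in>W. \<forall>w\<in>W. v + w \<in> W) \<and> (\<forall>c. \<forall>v\<in>W. c \<cdot>\<^sub>v v \<in> W)"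
  unfolding VectorSpace.subspace_def submodule_def
  using vec_vs[where 'a = complex, of n] vec_module[where 'a = complex, of n]
  by (auto simp: module_vec_simps)

lemma subspace_range:
  fixes A :: "complex mat"
  assumes A: "A \<in> carrier_mat n m"
  shows "VectorSpace.subspace class_ring ((\<lambda>v. A *\<^sub>v v) ` carrier_vec m) (module_vec TYPE(complex) n)"
  unfolding subspace_vec_iff
proof (intro conjI ballI allI)
  show "0\<^sub>v n \<in> (\<lambda>v. A *\<^sub>v v) ` carrier_vec m"
    using A by (intro image_eqI[of _ _ "0\<^sub>v m"]) auto
next
  fix v w assume "v \<in> (\<lambda>v. A *\<^sub>v v) ` carrier_vec m" "w \<in> (\<lambda>v. A *\<^sub>v v) ` carrier_vec m"
  then obtain x y where "x \<in> carrier_vec m" "y \<in> carrier_vec m" "v = A *\<^sub>v x" "w = A *\<^sub>v y" by auto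
  then show "v + w \<in> (\<lambda>v. A *\<^sub>v v) ` carrier_vec m"
    using A by (intro image_eqI[of _ _ "x + y"]) (auto simp: mult_add_distrib_mat_vec)
next
  fix c v assume "v \<in> (\<lambda>v. A *\<^sub>v v) ` carrier_vec m"
  then obtain x where "x \<in> carrier_vec m" "v = A *\<^sub>v x" by auto
  then show "c \<cdot>\<^sub>v v \<in> (\<lambda>v. A *\<^sub>v v) ` carrier_vec m"
    using A by (intro image_eqI[of _ _ "c \<cdot>\<^sub>v x"]) (auto simp: mult_mat_vec)
qed (use A in auto)

lemma subspace_kernel:
  fixes A :: "complex mat"
  assumes A: "A \<in> carrier_mat n m"
  shows "VectorSpace.subspace class_ring {v \<in> carrier_vec m. A *\<^sub>v v = 0\<^sub>v n} (module_vec TYPE(complex) m)"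
  unfolding subspace_vec_iff using A
  by (auto simp: mult_add_distrib_mat_vec mult_mat_vec)

definition inj_mat :: "'a::semiring_0 mat \<Rightarrow> bool" where
  "inj_mat A \<longleftrightarrow>
     (\<forall>v\<in>carrier_vec (dim_col A). A *\<^sub>v v = 0\<^sub>v (dim_row A) \<longrightarrow> v = 0\<^sub>v (dim_col A))"

lemma inj_matD:
  "inj_mat A \<Longrightarrow> A \<in> carrier_mat n m \<Longrightarrow> v \<in> carrier_vec m \<Longrightarrow> A *\<^sub>v v = 0\<^sub>v n \<Longrightarrow> v = 0\<^sub>v m"
  by (auto simp: inj_mat_def)

lemma inj_mat_left_cancel:
  fixes A :: "'a::field mat"
  assumes A: "A \<in> carrier_mat n m" "inj_mat A"
    and B: "B \<in> carrier_mat m k" and C: "C \<in> carrier_mat m k" and eq: "A * B = A * C"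
  shows "B = C"
proof (rule mat_eq_if_mult_vec_eq[OF B C])
  fix v :: "'a vec" assume v: "v \<in> carrier_vec k"
  have "A *\<^sub>v (B *\<^sub>v v) = A *\<^sub>v (C *\<^sub>v v)"
    using A B C v eq by (metis assoc_mult_mat_vec)
  then have "A *\<^sub>v (B *\<^sub>v v - C *\<^sub>v v) = 0\<^sub>v n"
    using A B C v by (subst mult_minus_distrib_mat_vec[of A n m]) auto
  then have "B *\<^sub>v v - C *\<^sub>v v = 0\<^sub>v m"
    using A B C v by - (rule inj_matD[OF A(2) A(1)], auto)
  then have d: "(B *\<^sub>v v - C *\<^sub>v v) $ i = 0" if "i < m" for i
    using that by simp
  show "B *\<^sub>v v = C *\<^sub>v v"
    using B C v by (intro eq_vecI) (use d in \<open>auto simp del: index_mult_mat_vec\<close>)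
qed

lemma inj_mat_dim_le:
  fixes A :: "'a::field mat"
  assumes A: "A \<in> carrier_mat n m" "inj_mat A"
  shows "m \<le> n"
proof (rule ccontr)
  assume "\<not> m \<le> n"
  then have nm: "n < m" by simp
  \<comment> \<open>With fewer rows than columns, padding by zero rows gives a singular square matrix.\<close>
  define B where "B = mat m m (\<lambda>(i,j). if i < n then A $$ (i,j) else 0)"
  have B: "B \<in> carrier_mat m m" by (simp add: B_def)
  have "det B = 0"
    using laplace_expansion_row[OF B nm] nm by (simp add: B_def)
  then obtain v where v: "v \<in> carrier_vec m" "v \<noteq> 0\<^sub>v m" "B *\<^sub>v v = 0\<^sub>v m"
    using det_0_iff_vec_prod_zero_field[OF B] by auto
  have "A *\<^sub>v v = 0\<^sub>v n"
  proof (rule eq_vecI)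
    fix i assume "i < dim_vec (0\<^sub>v n :: 'a vec)"
    then have i: "i < n" by simp
    have "row A i = row B i" using i nm A by (auto simp: B_def)
    then have "(A *\<^sub>v v) $ i = (B *\<^sub>v v) $ i" using i nm A B by simp
    then show "(A *\<^sub>v v) $ i = 0\<^sub>v n $ i" using v i nm by simp
  qed (use A in auto)
  then show False using inj_matD[of A n m v] A v by auto
qed

lemma inj_surj_mat_inverse:
  fixes A :: "complex mat"
  assumes A: "A \<in> carrier_mat n m" "inj_mat A"
    and surj: "(\<lambda>v. A *\<^sub>v v) ` carrier_vec m = carrier_vec n"
  shows "n = m \<and> (\<exists>R. R \<in> carrier_mat m n \<and> A * R = 1\<^sub>m n \<and> R * A = 1\<^sub>m m)"
proof -
  have "\<forall>j. \<exists>v. v \<in> carrier_vec m \<and> A *\<^sub>v v = unit_vec n j"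
    using surj by (metis (no_types, lifting) imageE unit_vec_carrier)
  then obtain f where f: "\<And>j. f j \<in> carrier_vec m" "\<And>j. A *\<^sub>v f j = unit_vec n j" by metis
  define R where "R = mat m n (\<lambda>(i,j). f j $ i)"
  have R: "R \<in> carrier_mat m n" by (simp add: R_def)
  have AR: "A * R = 1\<^sub>m n"
  proof (rule mat_col_eqI)
    fix j assume "j < dim_col (1\<^sub>m n :: complex mat)"
    then have j: "j < n" by simp
    have "col (A * R) j = A *\<^sub>v col R j" using A R j by (metis carrier_matD(2) col_mult2)
    also have "col R j = f j" using j f(1)[of j] by (auto simp: R_def)
    finally show "col (A * R) j = col (1\<^sub>m n) j" using j f by simp
  qed (use A R in auto)
  have "A * (R * A) = A * R * A"
    by (rule assoc_mult_mat[OF A(1) R A(1), symmetric])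
  also have "\<dots> = A * 1\<^sub>m m"
    unfolding AR using A by simp
  finally have "A * (R * A) = A * 1\<^sub>m m" .
  then have RA: "R * A = 1\<^sub>m m"
    using A R by - (rule inj_mat_left_cancel[OF A, of _ m], auto)
  \<comment> \<open>In characteristic zero the dimension of a space is the trace of its identity.\<close>
  have "(of_nat n :: complex) = mat_trace (A * R)" by (simp add: AR)
  also have "\<dots> = of_nat m" using mat_trace_comm[OF A(1) R] by (simp add: RA)
  finally have "n = m" by simp
  then show ?thesis using R AR RA by (intro conjI exI[of _ R])
qed

text \<open>
  Basis extension, with a basis encoded as the columns of an injective matrix: as long as the
  columns do not span \<open>W\<close>, append a vector of \<open>W\<close> outside of their span. Injectivity bounds
  the number of columns by \<open>n\<close>, so this stops.
\<close>
lemma extend_inj_mat_to_basis: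
  fixes P :: "complex mat"
  assumes "P \<in> carrier_mat n m" "inj_mat P"
    and W: "VectorSpace.subspace class_ring W (module_vec TYPE(complex) n)"
    and "(\<lambda>v. P *\<^sub>v v) ` carrier_vec m \<subseteq> W"
  shows "\<exists>m' P'. m \<le> m' \<and> P' \<in> carrier_mat n m' \<and> inj_mat P' \<and> (\<lambda>v. P' *\<^sub>v v) ` carrier_vec m' = W \<and>
           (\<forall>i<n. \<forall>j<m. P' $$ (i,j) = P $$ (i,j))"
  using assms(1,2,4)
proof (induction "n - m" arbitrary: m P rule: less_induct)
  case less
  note P = less.prems
  have Wc: "W \<subseteq> carrier_vec n" and Wadd: "\<And>v w. v \<in> W \<Longrightarrow> w \<in> W \<Longrightarrow> v + w \<in> W"
    and Wsm: "\<And>c v. v \<in> W \<Longrightarrow> c \<cdot>\<^sub>v v \<in> W"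
    using W by (auto simp: subspace_vec_iff)
  show ?case
  proof (cases "(\<lambda>v. P *\<^sub>v v) ` carrier_vec m = W")
    case True
    then show ?thesis using P by blast
  next
    case False
    then obtain w where w: "w \<in> W" "w \<notin> (\<lambda>v. P *\<^sub>v v) ` carrier_vec m" using P by blast
    have wc: "w \<in> carrier_vec n" using w Wc by auto
    define Q where "Q = mat n (Suc m) (\<lambda>(i,j). if j < m then P $$ (i,j) else w $ i)"
    have Q: "Q \<in> carrier_mat n (Suc m)" by (simp add: Q_def)
    have Qv: "Q *\<^sub>v v = P *\<^sub>v vec m (\<lambda>j. v $ j) + v $ m \<cdot>\<^sub>v w" if "v \<in> carrier_vec (Suc m)" for v
    proof (rule eq_vecI)
      fix i assume "i < dim_vec (P *\<^sub>v vec m (\<lambda>j. v $ j) + v $ m \<cdot>\<^sub>v w)"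
      then have i: "i < n" using P wc by simp
      have "(Q *\<^sub>v v) $ i = (\<Sum>j\<in>{0..<m}. P $$ (i,j) * v $ j) + w $ i * v $ m"
        using i that by (auto simp: Q_def scalar_prod_def)
      then show "(Q *\<^sub>v v) $ i = (P *\<^sub>v vec m (\<lambda>j. v $ j) + v $ m \<cdot>\<^sub>v w) $ i"
        using i P wc by (simp add: scalar_prod_def)
    qed (use P wc in \<open>auto simp: Q_def\<close>)
    have Qinj: "inj_mat Q"
      unfolding inj_mat_def
    proof (intro ballI impI)
      fix v assume "v \<in> carrier_vec (dim_col Q)" and "Q *\<^sub>v v = 0\<^sub>v (dim_row Q)"
      then have v: "v \<in> carrier_vec (Suc m)" and Qv0: "Q *\<^sub>v v = 0\<^sub>v n" using Q by auto
      define u where "u = vec m (\<lambda>j. v $ j)"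
      have u: "u \<in> carrier_vec m" by (simp add: u_def)
      have 0: "P *\<^sub>v u + v $ m \<cdot>\<^sub>v w = 0\<^sub>v n" using Qv[OF v] Qv0 by (simp add: u_def)
      have vm: "v $ m = 0"
      proof (rule ccontr)
        assume nz: "v $ m \<noteq> 0"
        have "w = P *\<^sub>v (- (1 / v $ m) \<cdot>\<^sub>v u)"
        proof (rule eq_vecI)
          fix i assume "i < dim_vec (P *\<^sub>v (- (1 / v $ m) \<cdot>\<^sub>v u))"
          then have i: "i < n" using P by simp
          have "(P *\<^sub>v u + v $ m \<cdot>\<^sub>v w) $ i = 0" using 0 i by simp
          then have "(P *\<^sub>v u) $ i + v $ m * w $ i = 0"
            using i P wc by (simp del: index_mult_mat_vec)
          then have "v $ m * w $ i = - (P *\<^sub>v u) $ i"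
            by (simp add: eq_neg_iff_add_eq_0 add.commute del: index_mult_mat_vec)
          then have "(v $ m * w $ i) / v $ m = - (1 / v $ m) * (P *\<^sub>v u) $ i"
            by (simp del: index_mult_mat_vec)
          then have "w $ i = - (1 / v $ m) * (P *\<^sub>v u) $ i"
            using nz by (simp del: index_mult_mat_vec)
          then show "w $ i = (P *\<^sub>v (- (1 / v $ m) \<cdot>\<^sub>v u)) $ i"
            using i P u mult_mat_vec[OF P(1) u] by (simp del: index_mult_mat_vec)
        qed (use P wc in auto)
        then have "w \<in> (\<lambda>v. P *\<^sub>v v) ` carrier_vec m"
          by (rule image_eqI) (use u in simp)
        then show False using w(2) by simp
      qed
      then have "v $ m \<cdot>\<^sub>v w = 0\<^sub>v n" using wc by (intro eq_vecI) auto
      then have "P *\<^sub>v u = 0\<^sub>v n"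
        using 0 right_zero_vec[OF mult_mat_vec_carrier[OF P(1) u]] by simp
      then have u0: "u = 0\<^sub>v m" using P u by - (rule inj_matD[OF P(2) P(1)], auto)
      have "v = 0\<^sub>v (Suc m)"
      proof (rule eq_vecI)
        fix i assume "i < dim_vec (0\<^sub>v (Suc m) :: complex vec)"
        then consider "i < m" | "i = m" by fastforce
        then show "v $ i = 0\<^sub>v (Suc m) $ i"
        proof cases
          case 1
          have "u $ i = v $ i" using 1 by (simp add: u_def)
          then show ?thesis using u0 1 by simp
        qed (use vm in simp)
      qed (use v in auto)
      then show "v = 0\<^sub>v (dim_col Q)" using Q by simp
    qed
    have QW: "(\<lambda>v. Q *\<^sub>v v) ` carrier_vec (Suc m) \<subseteq> W"
    proof
      fix x assume "x \<in> (\<lambda>v. Q *\<^sub>v v) ` carrier_vec (Suc m)"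
      then obtain v where v: "v \<in> carrier_vec (Suc m)" "x = Q *\<^sub>v v" by auto
      have "P *\<^sub>v vec m (\<lambda>j. v $ j) \<in> W" using P by auto
      then show "x \<in> W" using Qv[OF v(1)] v w Wadd Wsm by auto
    qed
    have "Suc m \<le> n" using inj_mat_dim_le[OF Q Qinj] .
    then have "n - Suc m < n - m" by simp
    from less.hyps[OF this Q Qinj QW] obtain m' P' where m': "Suc m \<le> m'" "P' \<in> carrier_mat n m'"
      "inj_mat P'" "(\<lambda>v. P' *\<^sub>v v) ` carrier_vec m' = W" "\<And>i j. i < n \<Longrightarrow> j < Suc m \<Longrightarrow> P' $$ (i,j) = Q $$ (i,j)"
      by blast
    have "\<forall>i<n. \<forall>j<m. P' $$ (i,j) = P $$ (i,j)" using m'(5) by (simp add: Q_def)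
    then show ?thesis using m' by (intro exI[of _ m'] exI[of _ P']) auto
  qed
qed

text \<open>
  Matrices of all dimensions share one type, which therefore has no zero to sum from; the
  dimensions of a sum have to be given.
\<close>
definition sum_mat :: "nat \<Rightarrow> nat \<Rightarrow> ('i \<Rightarrow> 'a::comm_monoid_add mat) \<Rightarrow> 'i set \<Rightarrow> 'a mat" where
  "sum_mat n m f S = mat n m (\<lambda>(i,j). \<Sum>x\<in>S. f x $$ (i,j))"

lemma sum_mat_carrier [simp]: "sum_mat n m f S \<in> carrier_mat n m"
  by (simp add: sum_mat_def)

lemma sum_mat_cong:
  "(\<And>x. x \<in> S \<Longrightarrow> f x = g x) \<Longrightarrow> sum_mat n m f S = sum_mat n m g S"
  by (simp add: sum_mat_def cong: sum.cong)

lemma sum_mat_reindex: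
  "bij_betw h S T \<Longrightarrow> sum_mat n m f T = sum_mat n m (\<lambda>x. f (h x)) S"
  unfolding sum_mat_def by (intro cong_mat) (auto simp: sum.reindex_bij_betw[symmetric])

lemma mult_sum_mat:
  fixes A :: "'a::semiring_0 mat"
  assumes A: "A \<in> carrier_mat k n" and f: "\<And>x. x \<in> S \<Longrightarrow> f x \<in> carrier_mat n m"
  shows "A * sum_mat n m f S = sum_mat k m (\<lambda>x. A * f x) S"
proof (rule eq_matI)
  fix i j assume "i < dim_row (sum_mat k m (\<lambda>x. A * f x) S)" "j < dim_col (sum_mat k m (\<lambda>x. A * f x) S)"
  then have i: "i < k" and j: "j < m" by (simp_all add: sum_mat_def)
  have "(A * sum_mat n m f S) $$ (i,j) = (\<Sum>l=0..<n. \<Sum>x\<in>S. A $$ (i,l) * f x $$ (l,j))"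
    using A i j by (simp add: sum_mat_def scalar_prod_def sum_distrib_left)
  also have "\<dots> = (\<Sum>x\<in>S. \<Sum>l=0..<n. A $$ (i,l) * f x $$ (l,j))"
    by (rule sum.swap)
  also have "\<dots> = (\<Sum>x\<in>S. (A * f x) $$ (i,j))"
    using A f i j by (intro sum.cong refl) (auto simp: scalar_prod_def dest!: f intro!: sum.cong)
  finally show "(A * sum_mat n m f S) $$ (i,j) = sum_mat k m (\<lambda>x. A * f x) S $$ (i,j)"
    using i j by (simp add: sum_mat_def)
qed (use A in \<open>auto simp: sum_mat_def\<close>)

lemma sum_mat_mult:
  fixes A :: "'a::semiring_0 mat"
  assumes A: "A \<in> carrier_mat m k" and f: "\<And>x. x \<in> S \<Longrightarrow> f x \<in> carrier_mat n m"
  shows "sum_mat n m f S * A = sum_mat n k (\<lambda>x. f x * A) S"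
proof (rule eq_matI)
  fix i j assume "i < dim_row (sum_mat n k (\<lambda>x. f x * A) S)" "j < dim_col (sum_mat n k (\<lambda>x. f x * A) S)"
  then have i: "i < n" and j: "j < k" by (simp_all add: sum_mat_def)
  have "(sum_mat n m f S * A) $$ (i,j) = (\<Sum>l=0..<m. \<Sum>x\<in>S. f x $$ (i,l) * A $$ (l,j))"
    using A i j by (simp add: sum_mat_def scalar_prod_def sum_distrib_right)
  also have "\<dots> = (\<Sum>x\<in>S. \<Sum>l=0..<m. f x $$ (i,l) * A $$ (l,j))"
    by (rule sum.swap)
  also have "\<dots> = (\<Sum>x\<in>S. (f x * A) $$ (i,j))"
    using A f i j by (intro sum.cong refl) (auto simp: scalar_prod_def dest!: f intro!: sum.cong)
  finally show "(sum_mat n m f S * A) $$ (i,j) = sum_mat n k (\<lambda>x. f x * A) S $$ (i,j)"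
    using i j by (simp add: sum_mat_def)
qed (use A in \<open>auto simp: sum_mat_def\<close>)

lemma mat_trace_sum_mat:
  assumes f: "\<And>x. x \<in> S \<Longrightarrow> f x \<in> carrier_mat n n"
  shows "mat_trace (sum_mat n n f S) = (\<Sum>x\<in>S. mat_trace (f x))"
proof -
  have "mat_trace (sum_mat n n f S) = (\<Sum>i<n. \<Sum>x\<in>S. f x $$ (i,i))"
    by (simp add: mat_trace_def sum_mat_def)
  also have "\<dots> = (\<Sum>x\<in>S. \<Sum>i<n. f x $$ (i,i))" by (rule sum.swap)
  also have "\<dots> = (\<Sum>x\<in>S. mat_trace (f x))"
    by (intro sum.cong refl) (auto simp: mat_trace_def dest!: f)
  finally show ?thesis .
qed

section \<open>Complex matrices of finite order\<close>

text \<open>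
  The diagonal of a triangular matrix is multiplicative, so that a relation satisfied by the
  matrix is satisfied by its eigenvalues.
\<close>
lemma triangular_power_diag:
  fixes B :: "complex mat"
  assumes B: "B \<in> carrier_mat n n" "upper_triangular B"
  shows "upper_triangular (B ^\<^sub>m k) \<and> (\<forall>i<n. (B ^\<^sub>m k) $$ (i,i) = (B $$ (i,i)) ^ k)"
proof (induction k)
  case 0
  then show ?case using B by auto
next
  case (Suc k)
  have c: "B ^\<^sub>m k \<in> carrier_mat n n" using B by simp
  have zero: "(B ^\<^sub>m k) $$ (i,l) = 0" if "l < i" "i < n" for i l
    using Suc that c by (auto simp: upper_triangular_def)
  have zeroB: "B $$ (i,l) = 0" if "l < i" "i < n" for i l
    using B that by (auto simp: upper_triangular_def)
  have entry: "(B ^\<^sub>m Suc k) $$ (i,j) = (\<Sum>l=0..<n. (B ^\<^sub>m k) $$ (i,l) * B $$ (l,j))" if "i < n" "j < n" for i j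
    using c B that by (simp add: scalar_prod_def)
  have "upper_triangular (B ^\<^sub>m Suc k)"
  proof (rule upper_triangularI)
    fix i j assume j: "j < i" and "i < dim_row (B ^\<^sub>m Suc k)"
    then have i: "i < n" using B by simp
    have "(B ^\<^sub>m k) $$ (i,l) * B $$ (l,j) = 0" if "l < n" for l
      using zero[of l i] zeroB[of j l] i j that by (cases "l < i") auto
    then have "(\<Sum>l=0..<n. (B ^\<^sub>m k) $$ (i,l) * B $$ (l,j)) = 0"
      by (intro sum.neutral) auto
    then show "(B ^\<^sub>m Suc k) $$ (i,j) = 0" using entry[of i j] i j by simp
  qed
  moreover have "(B ^\<^sub>m Suc k) $$ (i,i) = (B $$ (i,i)) ^ Suc k" if i: "i < n" for i
  proof -
    have "(B ^\<^sub>m k) $$ (i,l) * B $$ (l,i) = (if l = i then (B $$ (i,i)) ^ k * B $$ (i,i) else 0)" if "l < n" for l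
      using zero[of l i] zeroB[of i l] i that Suc by (cases l i rule: linorder_cases) auto
    then have "(B ^\<^sub>m Suc k) $$ (i,i) = (\<Sum>l=0..<n. if l = i then (B $$ (i,i)) ^ k * B $$ (i,i) else 0)"
      unfolding entry[OF i i] by (intro sum.cong) auto
    then show ?thesis using i by (simp add: sum.delta)
  qed
  ultimately show ?case by blast
qed

text \<open>
  Numbers of absolute value one have real part at most one, with equality only for \<open>1\<close>.
\<close>
lemma roots_of_unity_sum_eq_card:
  fixes d :: "nat \<Rightarrow> complex"
  assumes m: "m > 0" and root: "\<And>i. i < n \<Longrightarrow> d i ^ m = 1" and sum: "(\<Sum>i<n. d i) = of_nat n" and i: "i < n"
  shows "d i = 1"
proof -
  have norm: "norm (d j) = 1" if "j < n" for j
    using root[OF that] m by (metis norm_ge_zero norm_one norm_power power_eq_1_iff zero_less_iff_neq_zero power_eq_imp_eq_norm)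
  have "(\<Sum>j<n. 1 - Re (d j)) = 0"
  proof -
    have "Re (\<Sum>j<n. d j) = n" using sum by simp
    then show ?thesis by (simp add: sum_subtractf)
  qed
  moreover have "1 - Re (d j) \<ge> 0" if "j < n" for j
    using norm[OF that] complex_Re_le_cmod[of "d j"] by simp
  ultimately have "1 - Re (d i) = 0"
    using i sum_nonneg_eq_0_iff[of "{..<n}" "\<lambda>j. 1 - Re (d j)"] by auto
  then have re: "Re (d i) = 1" by simp
  then have "Im (d i) = 0" using norm[OF i] by (simp add: cmod_def)
  then show ?thesis using re by (simp add: complex_eq_iff)
qed

text \<open>
  In triangular form the diagonal consists of roots of unity with sum \<open>n\<close>, hence of ones. The
  sum \<open>S\<close> of the powers \<open>B ^ k\<close>, \<open>k < m\<close>, satisfies \<open>S * B = S\<close>, and it is triangular with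
  \<open>m\<close> on the diagonal, hence invertible; cancelling it gives \<open>B = 1\<close>.
\<close>
lemma finite_order_matrix_trace_eq_dim:
  fixes A :: "complex mat"
  assumes A: "A \<in> carrier_mat n n" and m: "m > 0" and pow: "A ^\<^sub>m m = 1\<^sub>m n" and tr: "mat_trace A = of_nat n"
  shows "A = 1\<^sub>m n"
proof -
  obtain as where "char_poly A = (\<Prod>a\<leftarrow>as. [:- a, 1:])" using char_poly_factorized[OF A] by blast
  from schur_decomposition_exists[OF A this] obtain B where B: "B \<in> carrier_mat n n" "upper_triangular B" "similar_mat A B"
    by blast
  obtain P Q where w: "similar_mat_wit A B P Q" using B(3) by (auto simp: similar_mat_def)
  note w' = similar_mat_witD2[OF A w]
  have "mat_trace A = mat_trace (Q * (P * B))"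
    unfolding w'(3) using w' by (intro mat_trace_comm[of _ n n]) auto
  also have "Q * (P * B) = B" using assoc_mult_mat[OF w'(7,6,5)] w' by simp
  finally have trB: "(\<Sum>i<n. B $$ (i,i)) = of_nat n" using tr w'(5) by (simp add: mat_trace_def)
  have "similar_mat_wit (A ^\<^sub>m m) (B ^\<^sub>m m) P Q" using similar_mat_wit_pow[OF w] .
  then have w2: "similar_mat_wit (1\<^sub>m n) (B ^\<^sub>m m) P Q" by (simp add: pow)
  note w2' = similar_mat_witD2[OF one_carrier_mat w2]
  have Bm: "B ^\<^sub>m m = 1\<^sub>m n"
    unfolding similar_mat_witD2(3)[OF w2'(5) similar_mat_wit_sym[OF w2]]
    using w'(2,7) by simp
  have diag_root: "(B $$ (i,i)) ^ m = 1" if "i < n" for i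
    using triangular_power_diag[OF B(1,2), of m] Bm that by simp
  have d1: "B $$ (i,i) = 1" if "i < n" for i
    using roots_of_unity_sum_eq_card[of m n "\<lambda>i. B $$ (i,i)" i] m diag_root trB that by simp
  define S where "S = sum_mat n n (\<lambda>k. B ^\<^sub>m k) {..<m}"
  have S: "S \<in> carrier_mat n n" by (simp add: S_def)
  have Bk: "B ^\<^sub>m k \<in> carrier_mat n n" for k using B by simp
  have SB: "S * B = S"
  proof -
    have "S * B = sum_mat n n (\<lambda>k. B ^\<^sub>m Suc k) {..<m}"
      unfolding S_def pow_mat.simps using Bk B by (intro sum_mat_mult) auto
    also have "\<dots> = S"
    proof (rule eq_matI)
      fix i j assume "i < dim_row S" "j < dim_col S"
      then have ij: "i < n" "j < n" using S by auto
      have "(\<Sum>k<m. (B ^\<^sub>m Suc k) $$ (i,j)) + (B ^\<^sub>m 0) $$ (i,j) = (\<Sum>k<m. (B ^\<^sub>m k) $$ (i,j)) + (B ^\<^sub>m m) $$ (i,j)"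
        using sum.lessThan_Suc_shift[of "\<lambda>k. (B ^\<^sub>m k) $$ (i,j)" m] by (simp add: add.commute del: pow_mat.simps)
      moreover have "(B ^\<^sub>m 0) $$ (i,j) = (B ^\<^sub>m m) $$ (i,j)" using Bm B by simp
      ultimately have "(\<Sum>k<m. (B ^\<^sub>m Suc k) $$ (i,j)) = (\<Sum>k<m. (B ^\<^sub>m k) $$ (i,j))" by simp
      then show "sum_mat n n (\<lambda>k. B ^\<^sub>m Suc k) {..<m} $$ (i,j) = S $$ (i,j)"
        using ij by (simp add: S_def sum_mat_def del: pow_mat.simps)
    qed (simp_all add: S_def sum_mat_def)
    finally show ?thesis .
  qed
  have "upper_triangular S"
    using triangular_power_diag[OF B(1,2)] B(1) by (auto simp: upper_triangular_def S_def sum_mat_def)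
  moreover have "S $$ (i,i) = of_nat m" if "i < n" for i
    using triangular_power_diag[OF B(1,2)] d1 that by (simp add: S_def sum_mat_def)
  ultimately have "det S \<noteq> 0"
    using det_upper_triangular[OF _ S] S m by (auto simp: prod_list_diag_prod)
  then obtain R where R: "R \<in> carrier_mat n n" "R * S = 1\<^sub>m n"
    using det_non_zero_imp_unit[OF S, of "()"] by (auto simp: Units_def ring_mat_simps)
  have "B = (R * S) * B" using B R by simp
  also have "\<dots> = R * (S * B)" by (rule assoc_mult_mat[OF R(1) S B(1)])
  also have "\<dots> = 1\<^sub>m n" using R SB by simp
  finally have "B = 1\<^sub>m n" .
  then show ?thesis using w' by simp
qed

section \<open>Representations and Schur's lemma\<close>

lemma mem_GL_complex_iff:
  "A \<in> carrier (GL_complex n) \<longleftrightarrow>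
     A \<in> carrier_mat n n \<and> (\<exists>B\<in>carrier_mat n n. B * A = 1\<^sub>m n \<and> A * B = 1\<^sub>m n)"
  by (simp add: GL_complex_def units_of_def Units_def ring_mat_simps)

lemma mult_GL_complex [simp]: "A \<otimes>\<^bsub>GL_complex n\<^esub> B = A * B"
  by (simp add: GL_complex_def units_of_def ring_mat_simps)

lemma one_GL_complex [simp]: "\<one>\<^bsub>GL_complex n\<^esub> = 1\<^sub>m n"
  by (simp add: GL_complex_def units_of_def ring_mat_simps)

lemma group_GL_complex: "group (GL_complex n)"
  unfolding GL_complex_def using ring_mat[where 'a = complex, of n "()"]
  by (intro monoid.units_group) (simp add: ring_def)

context group
begin

lemma representation_iff:
  "representation G n \<rho> \<longleftrightarrow>
     (\<forall>g\<in>carrier G. \<rho> g \<in> carrier_mat n n) \<and> \<rho> \<one> = 1\<^sub>m n \<and>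
     (\<forall>g\<in>carrier G. \<forall>h\<in>carrier G. \<rho> (g \<otimes> h) = \<rho> g * \<rho> h)" (is "_ \<longleftrightarrow> ?R")
proof
  assume "representation G n \<rho>"
  then have hom: "\<rho> \<in> hom G (GL_complex n)" by (simp add: representation_def)
  then have "\<rho> \<one> = 1\<^sub>m n"
    using hom_one[OF hom is_group group_GL_complex] by simp
  moreover have "\<rho> g \<in> carrier_mat n n" if "g \<in> carrier G" for g
    using hom_in_carrier[OF hom that] by (simp add: mem_GL_complex_iff)
  ultimately show ?R using hom_mult[OF hom] by simp
next
  assume R: ?R
  have "\<rho> g \<in> carrier (GL_complex n)" if g: "g \<in> carrier G" for g
    unfolding mem_GL_complex_iff using R g
    by (intro conjI bexI[of _ "\<rho> (inv g)"]) (metis inv_closed l_inv r_inv)+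
  then show "representation G n \<rho>"
    unfolding representation_def hom_def using R by auto
qed

lemma representation_carrier:
  "representation G n \<rho> \<Longrightarrow> g \<in> carrier G \<Longrightarrow> \<rho> g \<in> carrier_mat n n"
  by (simp add: representation_iff)

lemma representation_one: "representation G n \<rho> \<Longrightarrow> \<rho> \<one> = 1\<^sub>m n"
  by (simp add: representation_iff)

lemma representation_mult:
  "representation G n \<rho> \<Longrightarrow> g \<in> carrier G \<Longrightarrow> h \<in> carrier G \<Longrightarrow> \<rho> (g \<otimes> h) = \<rho> g * \<rho> h"
  by (simp add: representation_iff)

lemma irreducible_representationD:
  assumes "irreducible_representation G n \<rho>"
  shows "representation G n \<rho>" "0 < n"
    "\<And>W. VectorSpace.subspace class_ring W (module_vec TYPE(complex) n) \<Longrightarrow>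
       (\<And>g w. g \<in> carrier G \<Longrightarrow> w \<in> W \<Longrightarrow> \<rho> g *\<^sub>v w \<in> W) \<Longrightarrow> W = {0\<^sub>v n} \<or> W = carrier_vec n"
  using assms by (auto simp: irreducible_representation_def)

text \<open>
  Schur's lemma: the kernel and the range of an intertwiner are invariant subspaces.
\<close>
lemma intertwiner_zero_or_invertible:
  assumes \<rho>: "irreducible_representation G n \<rho>" and \<sigma>: "irreducible_representation G m \<sigma>"
    and T: "T \<in> carrier_mat n m" and comm: "\<And>g. g \<in> carrier G \<Longrightarrow> \<rho> g * T = T * \<sigma> g"
  shows "T = 0\<^sub>m n m \<or> (\<exists>R\<in>carrier_mat m n. T * R = 1\<^sub>m n \<and> R * T = 1\<^sub>m m)"
proof -
  note rho = irreducible_representationD[OF \<rho>] and sig = irreducible_representationD[OF \<sigma>]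
  have \<rho>c: "\<And>g. g \<in> carrier G \<Longrightarrow> \<rho> g \<in> carrier_mat n n"
    and \<sigma>c: "\<And>g. g \<in> carrier G \<Longrightarrow> \<sigma> g \<in> carrier_mat m m"
    using rho(1) sig(1) by (auto simp: representation_iff)
  have comm_vec: "\<rho> g *\<^sub>v (T *\<^sub>v v) = T *\<^sub>v (\<sigma> g *\<^sub>v v)" if "g \<in> carrier G" "v \<in> carrier_vec m" for g v
    using comm[OF that(1)] T \<rho>c[OF that(1)] \<sigma>c[OF that(1)] that(2)
    by (metis assoc_mult_mat_vec)
  let ?K = "{v \<in> carrier_vec m. T *\<^sub>v v = 0\<^sub>v n}" and ?I = "(\<lambda>v. T *\<^sub>v v) ` carrier_vec m"
  have "?K = {0\<^sub>v m} \<or> ?K = carrier_vec m"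
  proof (rule sig(3)[OF subspace_kernel[OF T]])
    fix g w assume g: "g \<in> carrier G" and "w \<in> ?K"
    then have w: "w \<in> carrier_vec m" "T *\<^sub>v w = 0\<^sub>v n" by auto
    have "T *\<^sub>v (\<sigma> g *\<^sub>v w) = \<rho> g *\<^sub>v 0\<^sub>v n" using comm_vec[OF g w(1)] w(2) by simp
    also have "\<dots> = 0\<^sub>v n" using \<rho>c[OF g] by auto
    finally show "\<sigma> g *\<^sub>v w \<in> ?K" using mult_mat_vec_carrier[OF \<sigma>c[OF g] w(1)] by simp
  qed
  moreover have "?I = {0\<^sub>v n} \<or> ?I = carrier_vec n"
  proof (rule rho(3)[OF subspace_range[OF T]])
    fix g w assume g: "g \<in> carrier G" and "w \<in> ?I"
    then obtain v where v: "v \<in> carrier_vec m" "w = T *\<^sub>v v" by auto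
    show "\<rho> g *\<^sub>v w \<in> ?I"
      unfolding v(2) comm_vec[OF g v(1)] using mult_mat_vec_carrier[OF \<sigma>c[OF g] v(1)] by (rule imageI)
  qed
  moreover have "T = 0\<^sub>m n m" if "?K = carrier_vec m"
  proof (rule mat_eq_if_mult_vec_eq[OF T])
    fix v :: "complex vec" assume v: "v \<in> carrier_vec m"
    then have "T *\<^sub>v v = 0\<^sub>v n" using that by blast
    then show "T *\<^sub>v v = 0\<^sub>m n m *\<^sub>v v" using v by auto
  qed simp
  moreover have "T = 0\<^sub>m n m" if "?I = {0\<^sub>v n}"
  proof (rule mat_eq_if_mult_vec_eq[OF T])
    fix v :: "complex vec" assume v: "v \<in> carrier_vec m"
    then have "T *\<^sub>v v = 0\<^sub>v n" using that by blast
    then show "T *\<^sub>v v = 0\<^sub>m n m *\<^sub>v v" using v by auto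
  qed simp
  moreover have "\<exists>R\<in>carrier_mat m n. T * R = 1\<^sub>m n \<and> R * T = 1\<^sub>m m"
    if K: "?K = {0\<^sub>v m}" and I: "?I = carrier_vec n"
  proof -
    have "inj_mat T" unfolding inj_mat_def
    proof (intro ballI impI)
      fix v assume "v \<in> carrier_vec (dim_col T)" "T *\<^sub>v v = 0\<^sub>v (dim_row T)"
      then have "v \<in> ?K" using T by auto
      then show "v = 0\<^sub>v (dim_col T)" using K T by auto
    qed
    then show ?thesis using inj_surj_mat_inverse[OF T _ I] by blast
  qed
  ultimately show ?thesis by argo
qed

text \<open>
  Schur's lemma over an algebraically closed field: subtract an eigenvalue and the difference,
  still an intertwiner, is no longer invertible.
\<close>
lemma schur_scalar:
  assumes \<rho>: "irreducible_representation G n \<rho>"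
    and T: "T \<in> carrier_mat n n" and comm: "\<And>g. g \<in> carrier G \<Longrightarrow> \<rho> g * T = T * \<rho> g"
  shows "\<exists>c. T = c \<cdot>\<^sub>m 1\<^sub>m n"
proof -
  note rho = irreducible_representationD[OF \<rho>]
  obtain c where "c \<in> spectrum T" using spectrum_non_empty[OF T rho(2)] by auto
  then have "eigenvalue T c" by (simp add: spectrum_def)
  then obtain v where "v \<in> carrier_vec n" "v \<noteq> 0\<^sub>v n" "T *\<^sub>v v = c \<cdot>\<^sub>v v"
    using T by (auto simp: eigenvalue_def eigenvector_def)
  note v = this
  \<comment> \<open>The eigenvector of \<open>T\<close> lies in the kernel of \<open>S\<close>, so \<open>S\<close> is an intertwiner without inverse.\<close>
  define S where "S = T - c \<cdot>\<^sub>m 1\<^sub>m n"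
  have S: "S \<in> carrier_mat n n" unfolding S_def by (intro minus_carrier_mat) simp
  have Sv: "S *\<^sub>v v = 0\<^sub>v n"
  proof -
    have "S *\<^sub>v v = T *\<^sub>v v - (c \<cdot>\<^sub>m 1\<^sub>m n) *\<^sub>v v"
      unfolding S_def using T v by (intro minus_mult_distrib_mat_vec) auto
    also have "(c \<cdot>\<^sub>m 1\<^sub>m n) *\<^sub>v v = c \<cdot>\<^sub>v v"
      using v by (intro eq_vecI) (auto simp: row_smult)
    finally show ?thesis using v by simp
  qed
  have Scomm: "\<rho> g * S = S * \<rho> g" if g: "g \<in> carrier G" for g
  proof -
    have r: "\<rho> g \<in> carrier_mat n n" using rho(1) g by (simp add: representation_iff)
    have "\<rho> g * S = \<rho> g * T - \<rho> g * (c \<cdot>\<^sub>m 1\<^sub>m n)"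
      unfolding S_def using T r by (intro mult_minus_distrib_mat) auto
    also have "\<rho> g * (c \<cdot>\<^sub>m 1\<^sub>m n) = (c \<cdot>\<^sub>m 1\<^sub>m n) * \<rho> g"
      using r mult_smult_distrib[OF r one_carrier_mat] mult_smult_assoc_mat[OF one_carrier_mat r] by simp
    also have "\<rho> g * T - (c \<cdot>\<^sub>m 1\<^sub>m n) * \<rho> g = S * \<rho> g"
      unfolding S_def comm[OF g] using T r by (intro minus_mult_distrib_mat[symmetric]) auto
    finally show ?thesis .
  qed
  have "\<not> (\<exists>R\<in>carrier_mat n n. S * R = 1\<^sub>m n \<and> R * S = 1\<^sub>m n)"
  proof
    assume "\<exists>R\<in>carrier_mat n n. S * R = 1\<^sub>m n \<and> R * S = 1\<^sub>m n"
    then obtain R where R: "R \<in> carrier_mat n n" "R * S = 1\<^sub>m n" by auto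
    have "v = (R * S) *\<^sub>v v" using v R by simp
    also have "\<dots> = R *\<^sub>v 0\<^sub>v n" using assoc_mult_mat_vec[OF R(1) S v(1)] Sv by simp
    also have "\<dots> = 0\<^sub>v n" using R by auto
    finally show False using v by simp
  qed
  then have "S = 0\<^sub>m n n" using intertwiner_zero_or_invertible[OF \<rho> \<rho> S Scomm] by blast
  then have S0: "S $$ (i,j) = 0" if "i < n" "j < n" for i j using that by simp
  have "T = c \<cdot>\<^sub>m 1\<^sub>m n"
    by (rule eq_matI) (use S0 T in \<open>auto simp: S_def\<close>)
  then show ?thesis ..
qed

lemma nonzero_intertwiner_character_eq:
  assumes \<rho>: "irreducible_representation G n \<rho>" and \<sigma>: "irreducible_representation G m \<sigma>"
    and T: "T \<in> carrier_mat n m" "T \<noteq> 0\<^sub>m n m"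
    and comm: "\<And>g. g \<in> carrier G \<Longrightarrow> \<rho> g * T = T * \<sigma> g"
  shows "character G \<rho> = character G \<sigma>"
proof -
  obtain R where R: "R \<in> carrier_mat m n" "T * R = 1\<^sub>m n" "R * T = 1\<^sub>m m"
    using intertwiner_zero_or_invertible[OF \<rho> \<sigma> T(1) comm] T(2) by blast
  have "mat_trace (\<rho> g) = mat_trace (\<sigma> g)" if g: "g \<in> carrier G" for g
  proof -
    have r: "\<rho> g \<in> carrier_mat n n" and s: "\<sigma> g \<in> carrier_mat m m"
      using irreducible_representationD(1)[OF \<rho>] irreducible_representationD(1)[OF \<sigma>] g
      by (auto simp: representation_iff)
    have "\<rho> g = \<rho> g * (T * R)" using r R by simp
    also have "\<dots> = T * \<sigma> g * R" using assoc_mult_mat[OF r T(1) R(1)] comm[OF g] by simp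
    finally have "mat_trace (\<rho> g) = mat_trace (T * \<sigma> g * R)" by simp
    also have "\<dots> = mat_trace (R * (T * \<sigma> g))"
      using T R s by (intro mat_trace_comm[of _ n m]) auto
    also have "R * (T * \<sigma> g) = \<sigma> g"
      using assoc_mult_mat[OF R(1) T(1) s] R(3) s by simp
    finally show ?thesis .
  qed
  then show ?thesis unfolding character_def by (intro restrict_ext) auto
qed

text \<open>
  Averaging over the group turns any matrix into an intertwiner, by the substitution of
  \<open>h \<otimes> g\<close> for \<open>g\<close>.
\<close>
lemma averaged_intertwiner:
  assumes \<rho>: "representation G n \<rho>" and \<sigma>: "representation G m \<sigma>"
    and Y: "Y \<in> carrier_mat n m" and h: "h \<in> carrier G"
  defines "T \<equiv> sum_mat n m (\<lambda>g. \<rho> g * Y * \<sigma> (inv g)) (carrier G)"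
  shows "\<rho> h * T = T * \<sigma> h"
proof -
  have r: "\<And>g. g \<in> carrier G \<Longrightarrow> \<rho> g \<in> carrier_mat n n" and s: "\<And>g. g \<in> carrier G \<Longrightarrow> \<sigma> g \<in> carrier_mat m m"
    using \<rho> \<sigma> by (auto simp: representation_iff)
  have c: "\<rho> g * Y * \<sigma> (inv g) \<in> carrier_mat n m" if "g \<in> carrier G" for g
    using r[OF that] Y s[of "inv g"] that by auto
  have "T * \<sigma> h = sum_mat n m (\<lambda>g. \<rho> g * Y * \<sigma> (inv g) * \<sigma> h) (carrier G)"
    unfolding T_def by (rule sum_mat_mult) (use c s h in auto)
  also have "\<dots> = sum_mat n m (\<lambda>g. \<rho> g * Y * \<sigma> (inv g \<otimes> h)) (carrier G)"
  proof (rule sum_mat_cong)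
    fix g assume g: "g \<in> carrier G"
    have rY: "\<rho> g * Y \<in> carrier_mat n m" using r[OF g] Y by simp
    show "\<rho> g * Y * \<sigma> (inv g) * \<sigma> h = \<rho> g * Y * \<sigma> (inv g \<otimes> h)"
      using representation_mult[OF \<sigma> _ h, of "inv g"] g
        assoc_mult_mat[OF rY s[of "inv g"] s[OF h]] by simp
  qed
  also have "\<dots> = sum_mat n m (\<lambda>g. \<rho> (h \<otimes> g) * Y * \<sigma> (inv (h \<otimes> g) \<otimes> h)) (carrier G)"
    by (rule sum_mat_reindex)
      (rule bij_betwI[where g = "\<lambda>g. inv h \<otimes> g"], use h in \<open>auto simp flip: m_assoc\<close>)
  also have "\<dots> = sum_mat n m (\<lambda>g. \<rho> h * (\<rho> g * Y * \<sigma> (inv g))) (carrier G)"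
  proof (rule sum_mat_cong)
    fix g assume g: "g \<in> carrier G"
    have e: "inv (h \<otimes> g) \<otimes> h = inv g" using g h by (simp add: inv_mult_group m_assoc)
    have sg: "\<sigma> (inv g) \<in> carrier_mat m m" using s g by simp
    have "\<rho> (h \<otimes> g) * Y * \<sigma> (inv g) = \<rho> h * \<rho> g * Y * \<sigma> (inv g)"
      using representation_mult[OF \<rho> h g] by simp
    also have "\<dots> = \<rho> h * (\<rho> g * Y) * \<sigma> (inv g)"
      using assoc_mult_mat[OF r[OF h] r[OF g] Y] by simp
    also have "\<dots> = \<rho> h * (\<rho> g * Y * \<sigma> (inv g))"
      using r[OF h] r[OF g] Y sg by (intro assoc_mult_mat[of _ n n _ m _ m]) auto
    finally show "\<rho> (h \<otimes> g) * Y * \<sigma> (inv (h \<otimes> g) \<otimes> h) = \<rho> h * (\<rho> g * Y * \<sigma> (inv g))"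
      by (simp add: e)
  qed
  also have "\<dots> = \<rho> h * T"
    unfolding T_def by (rule mult_sum_mat[symmetric]) (use c r h in auto)
  finally show ?thesis ..
qed

section \<open>Orthogonality of irreducible characters\<close>

lemma mem_IrrE:
  assumes "\<chi> \<in> Irr G"
  obtains \<rho> n where "irreducible_representation G n \<rho>" "\<And>g. g \<in> carrier G \<Longrightarrow> \<chi> g = mat_trace (\<rho> g)"
    "\<chi> = character G \<rho>" "\<chi> \<one> = of_nat n"
proof -
  obtain \<rho> n where *: "irreducible_representation G n \<rho>" "\<chi> = character G \<rho>"
    using assms by (auto simp: Irr_def)
  have "\<chi> \<one> = of_nat n"
    using representation_one[OF irreducible_representationD(1)[OF *(1)]] by (simp add: *(2) character_def)
  then show ?thesis using that[OF *(1) _ *(2)] by (simp add: *(2) character_def)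
qed

text \<open>
  The entries of the averages of matrix units are the inner products of matrix coefficients;
  Schur's lemma, which controls these averages, thereby yields the orthogonality relations.
\<close>
lemma averaged_matrix_unit_entry:
  assumes \<rho>: "representation G n \<rho>" and \<sigma>: "representation G m \<sigma>"
    and j: "j < n" and k: "k < m" and i: "i < n" and l: "l < m"
  defines "E \<equiv> mat n m (\<lambda>(a,b). if a = j \<and> b = k then 1 else 0 :: complex)"
  shows "sum_mat n m (\<lambda>g. \<rho> g * E * \<sigma> (inv g)) (carrier G) $$ (i,l) =
           (\<Sum>g\<in>carrier G. \<rho> g $$ (i,j) * \<sigma> (inv g) $$ (k,l))"
proof -
  have E: "E \<in> carrier_mat n m" by (simp add: E_def)
  have "(\<rho> g * E * \<sigma> (inv g)) $$ (i,l) = \<rho> g $$ (i,j) * \<sigma> (inv g) $$ (k,l)" if g: "g \<in> carrier G" for g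
  proof -
    have r: "\<rho> g \<in> carrier_mat n n" and s: "\<sigma> (inv g) \<in> carrier_mat m m"
      using \<rho> \<sigma> g by (auto simp: representation_iff)
    have "(\<rho> g * E) $$ (i,b) = (if b = k then \<rho> g $$ (i,j) else 0)" if b: "b < m" for b
    proof -
      have "(\<rho> g * E) $$ (i,b) = (\<Sum>a=0..<n. \<rho> g $$ (i,a) * (if a = j \<and> b = k then 1 else 0))"
        using r E i b by (simp add: scalar_prod_def E_def)
      also have "\<dots> = (\<Sum>a=0..<n. if a = j then (if b = k then \<rho> g $$ (i,a) else 0) else 0)"
        by (intro sum.cong) auto
      also have "\<dots> = (if b = k then \<rho> g $$ (i,j) else 0)" using j by (simp add: sum.delta)
      finally show ?thesis .
    qed
    note rE = this
    have "(M * \<sigma> (inv g)) $$ (i,l) = (\<Sum>b=0..<m. M $$ (i,b) * \<sigma> (inv g) $$ (b,l))"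
      if "M \<in> carrier_mat n m" for M
      using s i l that by (simp add: scalar_prod_def)
    then have "(\<rho> g * E * \<sigma> (inv g)) $$ (i,l) = (\<Sum>b=0..<m. (\<rho> g * E) $$ (i,b) * \<sigma> (inv g) $$ (b,l))"
      using r E by (meson mult_carrier_mat)
    also have "\<dots> = (\<Sum>b=0..<m. if b = k then \<rho> g $$ (i,j) * \<sigma> (inv g) $$ (b,l) else 0)"
      using rE by (intro sum.cong) auto
    also have "\<dots> = \<rho> g $$ (i,j) * \<sigma> (inv g) $$ (k,l)" using k by (simp add: sum.delta)
    finally show ?thesis .
  qed
  then show ?thesis using i l by (simp add: sum_mat_def)
qed

text \<open>
  The inner product is written with \<open>\<psi> (inv g)\<close>, for finite groups the complex conjugate of
  \<open>\<psi> g\<close>, because in this form it consists of entries of averages of matrix units. By Schur's lemma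
  such an average is zero for distinct characters, and otherwise a scalar matrix that is determined
  by its trace.
\<close>
lemma character_orthogonality:
  assumes \<chi>: "\<chi> \<in> Irr G" and \<psi>: "\<psi> \<in> Irr G"
  shows "(\<Sum>g\<in>carrier G. \<chi> g * \<psi> (inv g)) = (if \<chi> = \<psi> then of_nat (Coset.order G) else 0)"
proof -
  obtain \<rho> n where \<rho>: "irreducible_representation G n \<rho>" "\<And>g. g \<in> carrier G \<Longrightarrow> \<chi> g = mat_trace (\<rho> g)"
    and \<chi>_def: "\<chi> = character G \<rho>"
    using mem_IrrE[OF \<chi>] by metis
  obtain \<sigma> m where \<sigma>: "irreducible_representation G m \<sigma>" "\<And>g. g \<in> carrier G \<Longrightarrow> \<psi> g = mat_trace (\<sigma> g)"
    and \<psi>_def: "\<psi> = character G \<sigma>" and same: "\<chi> = \<psi> \<Longrightarrow> \<sigma> = \<rho> \<and> m = n"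
    using mem_IrrE[OF \<psi>] \<rho> \<chi>_def by metis
  note rep\<rho> = irreducible_representationD(1)[OF \<rho>(1)] and rep\<sigma> = irreducible_representationD(1)[OF \<sigma>(1)]
  define E :: "nat \<Rightarrow> nat \<Rightarrow> complex mat"
    where "E j k = mat n m (\<lambda>(a,b). if a = j \<and> b = k then 1 else 0)" for j k
  define T where "T j k = sum_mat n m (\<lambda>g. \<rho> g * E j k * \<sigma> (inv g)) (carrier G)" for j k
  have Tc: "T j k \<in> carrier_mat n m" for j k by (simp add: T_def)
  have comm: "\<rho> h * T j k = T j k * \<sigma> h" if "h \<in> carrier G" for h j k
    unfolding T_def using averaged_intertwiner[OF rep\<rho> rep\<sigma> _ that] by (simp add: E_def)
  have "(\<Sum>g\<in>carrier G. \<chi> g * \<psi> (inv g)) =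
          (\<Sum>g\<in>carrier G. (\<Sum>i<n. \<rho> g $$ (i,i)) * (\<Sum>k<m. \<sigma> (inv g) $$ (k,k)))"
  proof (intro sum.cong refl)
    fix g assume g: "g \<in> carrier G"
    then show "\<chi> g * \<psi> (inv g) = (\<Sum>i<n. \<rho> g $$ (i,i)) * (\<Sum>k<m. \<sigma> (inv g) $$ (k,k))"
      using \<rho>(2) \<sigma>(2) representation_carrier[OF rep\<rho> g] representation_carrier[OF rep\<sigma>, of "inv g"]
      by (simp add: mat_trace_def)
  qed
  also have "\<dots> = (\<Sum>g\<in>carrier G. \<Sum>i<n. \<Sum>k<m. \<rho> g $$ (i,i) * \<sigma> (inv g) $$ (k,k))"
    by (simp add: sum_product)
  also have "\<dots> = (\<Sum>i<n. \<Sum>g\<in>carrier G. \<Sum>k<m. \<rho> g $$ (i,i) * \<sigma> (inv g) $$ (k,k))"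
    by (rule sum.swap)
  also have "\<dots> = (\<Sum>i<n. \<Sum>k<m. \<Sum>g\<in>carrier G. \<rho> g $$ (i,i) * \<sigma> (inv g) $$ (k,k))"
    by (intro sum.cong refl sum.swap)
  also have "\<dots> = (\<Sum>i<n. \<Sum>k<m. T i k $$ (i,k))"
    unfolding T_def E_def
    by (intro sum.cong refl averaged_matrix_unit_entry[OF rep\<rho> rep\<sigma>, symmetric]) auto
  finally have main: "(\<Sum>g\<in>carrier G. \<chi> g * \<psi> (inv g)) = (\<Sum>i<n. \<Sum>k<m. T i k $$ (i,k))" .
  show ?thesis
  proof (cases "\<chi> = \<psi>")
    case False
    then have "T i k = 0\<^sub>m n m" for i k
      using nonzero_intertwiner_character_eq[OF \<rho>(1) \<sigma>(1) Tc _ comm] \<chi>_def \<psi>_def by blast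
    then show ?thesis using False main by simp
  next
    case True
    then have same: "\<sigma> = \<rho>" "m = n" using same by auto
    have n0: "n > 0" using irreducible_representationD(2)[OF \<rho>(1)] .
    have entry: "T i k $$ (i,k) = (if k = i then of_nat (Coset.order G) / of_nat n else 0)" if i: "i < n" and k: "k < n" for i k
    proof -
      obtain c where c: "T i k = c \<cdot>\<^sub>m 1\<^sub>m n"
        using schur_scalar[OF \<rho>(1), of "T i k"] Tc comm same by auto
      have "c * of_nat n = mat_trace (T i k)"
        unfolding c by (subst mat_trace_smult[of _ n]) auto
      also have "\<dots> = (\<Sum>g\<in>carrier G. mat_trace (\<rho> g * E i k * \<rho> (inv g)))"
        unfolding T_def same
        by (rule mat_trace_sum_mat)
          (auto simp: E_def same intro!: mult_carrier_mat representation_carrier[OF rep\<rho>])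
      also have "\<dots> = (\<Sum>g\<in>carrier G. mat_trace (E i k))"
      proof (intro sum.cong refl)
        fix g assume g: "g \<in> carrier G"
        have r: "\<rho> g \<in> carrier_mat n n" "\<rho> (inv g) \<in> carrier_mat n n" "E i k \<in> carrier_mat n n"
          using representation_carrier[OF rep\<rho>] g by (auto simp: E_def same)
        have "mat_trace (\<rho> g * E i k * \<rho> (inv g)) = mat_trace (\<rho> (inv g) * (\<rho> g * E i k))"
          using r by (intro mat_trace_comm[of _ n n]) auto
        also have "\<rho> (inv g) * (\<rho> g * E i k) = \<rho> (inv g \<otimes> g) * E i k"
          using representation_mult[OF rep\<rho>, of "inv g" g] g assoc_mult_mat[OF r(2,1,3)] by simp
        also have "\<dots> = E i k" using g r representation_one[OF rep\<rho>] by simp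
        finally show "mat_trace (\<rho> g * E i k * \<rho> (inv g)) = mat_trace (E i k)" .
      qed
      also have "\<dots> = of_nat (Coset.order G) * mat_trace (E i k)"
        by (simp add: Coset.order_def)
      also have "mat_trace (E i k) = (\<Sum>a<n. if a = i then (if a = k then 1 else 0) else 0)"
        by (auto simp: mat_trace_def E_def same intro!: sum.cong)
      also have "\<dots> = (if k = i then 1 else 0)" using i by (simp add: sum.delta)
      finally have "c * of_nat n = (if k = i then of_nat (Coset.order G) else 0)" by simp
      then have cval: "c = (if k = i then of_nat (Coset.order G) / of_nat n else 0)"
        using n0 by (auto simp: field_simps)
      then show ?thesis unfolding c using i k by auto
    qed
    have "(\<Sum>i<n. \<Sum>k<m. T i k $$ (i,k)) = (\<Sum>i<n. \<Sum>k<n. if k = i then of_nat (Coset.order G) / of_nat n else 0)"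
      unfolding same(2) by (intro sum.cong refl entry) auto
    also have "\<dots> = (\<Sum>i<n. of_nat (Coset.order G) / of_nat n)" by (simp add: sum.delta)
    also have "\<dots> = of_nat (Coset.order G)" using n0 by simp
    finally show ?thesis using True main by simp
  qed
qed

section \<open>Decomposition into irreducible characters and the regular character\<close>

text \<open>
  In a basis that extends a basis of \<open>W\<close> all matrices become block triangular, and the two
  diagonal blocks, the subrepresentation and the quotient, carry the trace.
\<close>
lemma reducible_representation_splits:
  assumes \<rho>: "representation G n \<rho>"
    and W: "VectorSpace.subspace class_ring W (module_vec TYPE(complex) n)"
    and inv: "\<And>g w. g \<in> carrier G \<Longrightarrow> w \<in> W \<Longrightarrow> \<rho> g *\<^sub>v w \<in> W"
    and W0: "W \<noteq> {0\<^sub>v n}" and W1: "W \<noteq> carrier_vec n"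
  shows "\<exists>m \<sigma> \<tau>. 0 < m \<and> m < n \<and> representation G m \<sigma> \<and> representation G (n - m) \<tau> \<and>
           (\<forall>g\<in>carrier G. mat_trace (\<rho> g) = mat_trace (\<sigma> g) + mat_trace (\<tau> g))"
proof -
  have Wc: "W \<subseteq> carrier_vec n" and W0mem: "0\<^sub>v n \<in> W" using W by (auto simp: subspace_vec_iff)
  have full: "VectorSpace.subspace class_ring (carrier_vec n) (module_vec TYPE(complex) n)"
    by (auto simp: subspace_vec_iff)
  have e: "(\<lambda>v. 0\<^sub>m n 0 *\<^sub>v v) ` carrier_vec 0 \<subseteq> W"
  proof
    fix x :: "complex vec" assume "x \<in> (\<lambda>v. 0\<^sub>m n 0 *\<^sub>v v) ` carrier_vec 0"
    then obtain v :: "complex vec" where "v \<in> carrier_vec 0" "x = 0\<^sub>m n 0 *\<^sub>v v" by auto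
    then have "x = 0\<^sub>v n" by (intro eq_vecI) (auto simp: scalar_prod_def)
    then show "x \<in> W" using W0mem by simp
  qed
  have i0: "inj_mat (0\<^sub>m n 0 :: complex mat)" by (auto simp: inj_mat_def)
  obtain m P0 where P0: "P0 \<in> carrier_mat n m" "inj_mat P0" "(\<lambda>v. P0 *\<^sub>v v) ` carrier_vec m = W"
    using extend_inj_mat_to_basis[OF _ i0 W e] by auto
  have P0full: "(\<lambda>v. P0 *\<^sub>v v) ` carrier_vec m \<subseteq> carrier_vec n" using P0 Wc by simp
  obtain n' P where P: "m \<le> n'" "P \<in> carrier_mat n n'" "inj_mat P"
    "(\<lambda>v. P *\<^sub>v v) ` carrier_vec n' = carrier_vec n" and PP: "\<forall>i<n. \<forall>j<m. P $$ (i,j) = P0 $$ (i,j)"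
    using extend_inj_mat_to_basis[OF P0(1,2) full P0full] by (elim exE conjE) (rule that)
  have PP0: "\<And>i j. i < n \<Longrightarrow> j < m \<Longrightarrow> P $$ (i,j) = P0 $$ (i,j)" using PP by simp
  obtain R where n': "n' = n" and R: "R \<in> carrier_mat n n" "P * R = 1\<^sub>m n" "R * P = 1\<^sub>m n"
    using inj_surj_mat_inverse[OF P(2,3,4)] by blast
  have Pc: "P \<in> carrier_mat n n" and mn: "m \<le> n" using P n' by auto
  have "m \<noteq> n"
  proof
    assume "m = n"
    then have "P0 = P" using P0 Pc PP0 by (intro eq_matI) auto
    then show False using P0(3) P(4) W1 \<open>m = n\<close> n' by simp
  qed
  then have mlt: "m < n" using mn by simp
  have m0: "0 < m"
  proof (rule ccontr)
    assume "\<not> 0 < m"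
    then have m: "m = 0" by simp
    have "W \<subseteq> {0\<^sub>v n}"
    proof
      fix x assume "x \<in> W"
      then obtain v where "v \<in> carrier_vec 0" "x = P0 *\<^sub>v v" using P0(3) m by auto
      then have "x = 0\<^sub>v n" using P0(1) m by (intro eq_vecI) (auto simp: scalar_prod_def)
      then show "x \<in> {0\<^sub>v n}" by simp
    qed
    then show False using W0 W0mem by auto
  qed
  define B where "B g = R * \<rho> g * P" for g
  have r: "\<rho> g \<in> carrier_mat n n" if "g \<in> carrier G" for g using representation_carrier[OF \<rho> that] .
  have Bc: "B g \<in> carrier_mat n n" if "g \<in> carrier G" for g using r[OF that] R Pc by (simp add: B_def)
  have B1: "B \<one> = 1\<^sub>m n" using representation_one[OF \<rho>] R Pc by (simp add: B_def)
  have Bmult: "B (g \<otimes> h) = B g * B h" if g: "g \<in> carrier G" and h: "h \<in> carrier G" for g h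
  proof -
    have Rg: "R * \<rho> g \<in> carrier_mat n n" and hP: "\<rho> h * P \<in> carrier_mat n n"
      using r[OF g] r[OF h] R Pc by auto
    have "B g * B h = (R * \<rho> g) * (P * (R * \<rho> h * P))"
      unfolding B_def using assoc_mult_mat[OF Rg Pc, of "R * \<rho> h * P" n] R r[OF h] Pc by simp
    also have "P * (R * \<rho> h * P) = P * (R * (\<rho> h * P))"
      using assoc_mult_mat[OF R(1) r[OF h] Pc] by simp
    also have "\<dots> = \<rho> h * P"
      by (subst assoc_mult_mat[OF Pc R(1) hP, symmetric]) (simp add: R(2) left_mult_one_mat[OF hP])
    also have "(R * \<rho> g) * (\<rho> h * P) = R * (\<rho> g * \<rho> h) * P"
      using assoc_mult_mat[OF Rg r[OF h] Pc] assoc_mult_mat[OF R(1) r[OF g] r[OF h]] by simp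
    finally show ?thesis using representation_mult[OF \<rho> g h] by (simp add: B_def)
  qed
  have Btrace: "mat_trace (B g) = mat_trace (\<rho> g)" if g: "g \<in> carrier G" for g
  proof -
    have "mat_trace (B g) = mat_trace (P * (R * \<rho> g))"
      unfolding B_def using R Pc r[OF g] by (intro mat_trace_comm[of _ n n]) auto
    also have "P * (R * \<rho> g) = \<rho> g"
      by (subst assoc_mult_mat[OF Pc R(1) r[OF g], symmetric]) (simp add: R(2) left_mult_one_mat[OF r[OF g]])
    finally show ?thesis .
  qed
  \<comment> \<open>The first \<open>m\<close> basis vectors span \<open>W\<close>, so invariance means that the lower left block vanishes.\<close>
  have B0: "B g $$ (i,j) = 0" if g: "g \<in> carrier G" and i: "m \<le> i" "i < n" and j: "j < m" for g i j
  proof -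
    have jn: "j < n" using j mlt by simp
    have "P *\<^sub>v unit_vec n j = P0 *\<^sub>v unit_vec m j"
    proof (rule eq_vecI)
      fix a assume "a < dim_vec (P0 *\<^sub>v unit_vec m j)"
      then have a: "a < n" using P0 by simp
      show "(P *\<^sub>v unit_vec n j) $ a = (P0 *\<^sub>v unit_vec m j) $ a"
        using a j jn Pc P0 PP0[OF a j] by simp
    qed (use Pc P0 in auto)
    then have "P *\<^sub>v unit_vec n j \<in> W" using P0(3) by (metis imageI unit_vec_carrier)
    then have "\<rho> g *\<^sub>v (P *\<^sub>v unit_vec n j) \<in> W" using inv[OF g] by simp
    then obtain x where x: "x \<in> carrier_vec m" "\<rho> g *\<^sub>v (P *\<^sub>v unit_vec n j) = P0 *\<^sub>v x"
      using P0(3) by auto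
    define y where "y = vec n (\<lambda>a. if a < m then x $ a else 0)"
    have y: "y \<in> carrier_vec n" by (simp add: y_def)
    have Py: "P *\<^sub>v y = P0 *\<^sub>v x"
    proof (rule eq_vecI)
      fix a assume "a < dim_vec (P0 *\<^sub>v x)"
      then have a: "a < n" using P0 by simp
      have "(P *\<^sub>v y) $ a = (\<Sum>b\<in>{0..<n}. if b < m then P $$ (a,b) * x $ b else 0)"
        using a Pc y by (auto simp: scalar_prod_def y_def intro!: sum.cong)
      also have "\<dots> = (\<Sum>b\<in>{0..<m}. P $$ (a,b) * x $ b)"
        using mlt by (intro sum.mono_neutral_cong_right) auto
      also have "\<dots> = (P0 *\<^sub>v x) $ a"
        using a P0 x PP0 by (auto simp: scalar_prod_def intro!: sum.cong)
      finally show "(P *\<^sub>v y) $ a = (P0 *\<^sub>v x) $ a" .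
    qed (use Pc P0 in auto)
    have "B g *\<^sub>v unit_vec n j = R *\<^sub>v (\<rho> g *\<^sub>v (P *\<^sub>v unit_vec n j))"
      unfolding B_def using assoc_mult_mat_vec[of "R * \<rho> g" n n P n "unit_vec n j"]
        assoc_mult_mat_vec[OF R(1) r[OF g], of "P *\<^sub>v unit_vec n j"] R r[OF g] Pc by simp
    also have "\<dots> = R *\<^sub>v (P *\<^sub>v y)" by (simp add: x Py)
    also have "\<dots> = y"
      by (subst assoc_mult_mat_vec[OF R(1) Pc y, symmetric]) (simp add: R(3) one_mult_mat_vec[OF y])
    finally have "(B g *\<^sub>v unit_vec n j) $ i = y $ i" by simp
    then show ?thesis using Bc[OF g] i jn by (simp add: y_def)
  qed
  have Bij: "B (g \<otimes> h) $$ (i,j) = (\<Sum>k=0..<n. B g $$ (i,k) * B h $$ (k,j))"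
    if "g \<in> carrier G" "h \<in> carrier G" "i < n" "j < n" for g h i j
    using Bmult[OF that(1,2)] Bc[OF that(1)] Bc[OF that(2)] that(3,4) by (simp add: scalar_prod_def)
  define \<sigma> where "\<sigma> g = mat m m (\<lambda>(i,j). B g $$ (i,j))" for g
  define \<tau> where "\<tau> g = mat (n - m) (n - m) (\<lambda>(i,j). B g $$ (i + m, j + m))" for g
  have "representation G m \<sigma>"
    unfolding representation_iff
  proof (intro conjI ballI)
    show "\<sigma> \<one> = 1\<^sub>m m" using mlt by (intro eq_matI) (auto simp: \<sigma>_def B1)
    fix g h assume g: "g \<in> carrier G" and h: "h \<in> carrier G"
    show "\<sigma> (g \<otimes> h) = \<sigma> g * \<sigma> h"
    proof (rule eq_matI)
      fix i j assume "i < dim_row (\<sigma> g * \<sigma> h)" "j < dim_col (\<sigma> g * \<sigma> h)"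
      then have i: "i < m" and j: "j < m" by (auto simp: \<sigma>_def)
      have "\<sigma> (g \<otimes> h) $$ (i,j) = (\<Sum>k=0..<n. B g $$ (i,k) * B h $$ (k,j))"
        using Bij[OF g h, of i j] i j mlt by (simp add: \<sigma>_def)
      also have "\<dots> = (\<Sum>k=0..<m. B g $$ (i,k) * B h $$ (k,j))"
        using mlt B0[OF h _ _ j] by (intro sum.mono_neutral_right) auto
      also have "\<dots> = (\<sigma> g * \<sigma> h) $$ (i,j)" using i j by (simp add: \<sigma>_def scalar_prod_def)
      finally show "\<sigma> (g \<otimes> h) $$ (i,j) = (\<sigma> g * \<sigma> h) $$ (i,j)" .
    qed (auto simp: \<sigma>_def)
  qed (auto simp: \<sigma>_def)
  moreover have "representation G (n - m) \<tau>"
    unfolding representation_iff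
  proof (intro conjI ballI)
    show "\<tau> \<one> = 1\<^sub>m (n - m)" by (intro eq_matI) (auto simp: \<tau>_def B1)
    fix g h assume g: "g \<in> carrier G" and h: "h \<in> carrier G"
    show "\<tau> (g \<otimes> h) = \<tau> g * \<tau> h"
    proof (rule eq_matI)
      fix i j assume "i < dim_row (\<tau> g * \<tau> h)" "j < dim_col (\<tau> g * \<tau> h)"
      then have i: "i < n - m" and j: "j < n - m" by (auto simp: \<tau>_def)
      have "\<tau> (g \<otimes> h) $$ (i,j) = (\<Sum>k=0..<n. B g $$ (i + m,k) * B h $$ (k,j + m))"
        using Bij[OF g h, of "i + m" "j + m"] i j by (simp add: \<tau>_def)
      also have "\<dots> = (\<Sum>k=0+m..<(n-m)+m. B g $$ (i + m,k) * B h $$ (k,j + m))"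
        using mlt B0[OF g, of "i + m"] i by (intro sum.mono_neutral_right) auto
      also have "\<dots> = (\<Sum>k=0..<n-m. B g $$ (i + m,k + m) * B h $$ (k + m,j + m))"
        by (rule sum.shift_bounds_nat_ivl)
      also have "\<dots> = (\<tau> g * \<tau> h) $$ (i,j)" using i j by (simp add: \<tau>_def scalar_prod_def)
      finally show "\<tau> (g \<otimes> h) $$ (i,j) = (\<tau> g * \<tau> h) $$ (i,j)" .
    qed (auto simp: \<tau>_def)
  qed (auto simp: \<tau>_def)
  moreover have "mat_trace (\<rho> g) = mat_trace (\<sigma> g) + mat_trace (\<tau> g)" if g: "g \<in> carrier G" for g
  proof -
    have "mat_trace (\<rho> g) = (\<Sum>i=0..<n. B g $$ (i,i))"
      using Btrace[OF g] Bc[OF g] by (simp add: mat_trace_def atLeast0LessThan)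
    also have "\<dots> = (\<Sum>i=0..<m. B g $$ (i,i)) + (\<Sum>i=0+m..<(n-m)+m. B g $$ (i,i))"
      using mlt by (simp add: sum.atLeastLessThan_concat)
    also have "(\<Sum>i=0+m..<(n-m)+m. B g $$ (i,i)) = (\<Sum>i=0..<n-m. B g $$ (i+m,i+m))"
      by (rule sum.shift_bounds_nat_ivl)
    finally show ?thesis by (simp add: mat_trace_def \<sigma>_def \<tau>_def atLeast0LessThan)
  qed
  ultimately show ?thesis using m0 mlt by blast
qed

text \<open>
  The list records the characters of the composition factors with multiplicity.
\<close>
lemma representation_trace_is_sum_of_irreducibles:
  assumes "representation G n \<rho>"
  shows "\<exists>xs. set xs \<subseteq> Irr G \<and> (\<forall>g\<in>carrier G. mat_trace (\<rho> g) = (\<Sum>\<chi>\<leftarrow>xs. \<chi> g))"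
  using assms
proof (induction n arbitrary: \<rho> rule: less_induct)
  case (less n)
  consider "n = 0" | "irreducible_representation G n \<rho>" | "0 < n" "\<not> irreducible_representation G n \<rho>" by blast
  then show ?case
  proof cases
    case 1
    then have "mat_trace (\<rho> g) = 0" if "g \<in> carrier G" for g
      using representation_carrier[OF less.prems that] by (simp add: mat_trace_def)
    then show ?thesis by (intro exI[of _ "[]"]) simp
  next
    case 2
    then have "character G \<rho> \<in> Irr G" by (auto simp: Irr_def)
    then show ?thesis by (intro exI[of _ "[character G \<rho>]"]) (simp add: character_def)
  next
    case 3
    then obtain W where W: "VectorSpace.subspace class_ring W (module_vec TYPE(complex) n)"
      "\<And>g w. g \<in> carrier G \<Longrightarrow> w \<in> W \<Longrightarrow> \<rho> g *\<^sub>v w \<in> W" "W \<noteq> {0\<^sub>v n}" "W \<noteq> carrier_vec n"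
      using less.prems unfolding irreducible_representation_def by blast
    from reducible_representation_splits[OF less.prems W]
    obtain m \<sigma> \<tau> where m: "0 < m" "m < n" "representation G m \<sigma>" "representation G (n - m) \<tau>"
      "\<And>g. g \<in> carrier G \<Longrightarrow> mat_trace (\<rho> g) = mat_trace (\<sigma> g) + mat_trace (\<tau> g)" by blast
    obtain xs where xs: "set xs \<subseteq> Irr G" "\<forall>g\<in>carrier G. mat_trace (\<sigma> g) = (\<Sum>\<chi>\<leftarrow>xs. \<chi> g)"
      using less.IH[OF m(2,3)] by blast
    obtain ys where ys: "set ys \<subseteq> Irr G" "\<forall>g\<in>carrier G. mat_trace (\<tau> g) = (\<Sum>\<chi>\<leftarrow>ys. \<chi> g)"
      using less.IH[OF _ m(4)] m(1,2) by auto
    show ?thesis using m(5) xs ys by (intro exI[of _ "xs @ ys"]) auto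
  qed
qed

lemma principal_character_in_Irr: "principal_character G \<in> Irr G"
proof -
  have W: "W = {0\<^sub>v 1} \<or> W = carrier_vec 1"
    if W: "VectorSpace.subspace class_ring W (module_vec TYPE(complex) 1)" for W
  proof (cases "W = {0\<^sub>v 1}")
    case False
    then obtain w where w: "w \<in> W" "w \<noteq> 0\<^sub>v 1" using W by (auto simp: subspace_vec_iff)
    have wc: "w \<in> carrier_vec 1" using w W by (auto simp: subspace_vec_iff)
    then have w0: "w $ 0 \<noteq> 0" using w(2) by (metis eq_vecI carrier_vecD index_zero_vec(1,2) less_one)
    have "carrier_vec 1 \<subseteq> W"
    proof
      fix v :: "complex vec" assume v: "v \<in> carrier_vec 1"
      have "v = (v $ 0 / w $ 0) \<cdot>\<^sub>v w" using v wc w0 by (intro eq_vecI) auto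
      then show "v \<in> W" using W w(1) unfolding subspace_vec_iff by metis
    qed
    then show ?thesis using W by (auto simp: subspace_vec_iff)
  qed simp
  have "irreducible_representation G 1 (\<lambda>_. 1\<^sub>m 1)"
    unfolding irreducible_representation_def representation_iff using W by auto
  moreover have "principal_character G = character G (\<lambda>_. 1\<^sub>m 1)"
    by (simp add: principal_character_def character_def)
  ultimately show ?thesis unfolding Irr_def by blast
qed

end

locale finite_group = group +
  assumes finite_carrier [simp]: "finite (carrier G)"
begin

lemma order_pos: "0 < Coset.order G"
  using finite_carrier order_gt_0_iff_finite by blast

text \<open>
  The group acts on itself by left multiplication, without fixed points unless \<open>g\<close> is the identity;
  an enumeration of the group makes this a representation by permutation matrices.
\<close>
lemma regular_representation:
  "\<exists>\<rho>. representation G (Coset.order G) \<rho> \<and>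
     (\<forall>g\<in>carrier G. mat_trace (\<rho> g) = (if g = \<one> then of_nat (Coset.order G) else 0))"
proof -
  let ?N = "Coset.order G"
  obtain e where e: "bij_betw e {0..<?N} (carrier G)"
    using ex_bij_betw_nat_finite[OF finite_carrier] by (auto simp: Coset.order_def)
  have ec: "e i \<in> carrier G" if "i < ?N" for i using e that by (auto simp: bij_betw_def)
  have einj: "e i = e j \<longleftrightarrow> i = j" if "i < ?N" "j < ?N" for i j
    using e that by (auto simp: bij_betw_def inj_on_def)
  have esurj: "\<exists>k<?N. e k = x" if "x \<in> carrier G" for x
    using e that by (force simp: bij_betw_def)
  define \<rho> where "\<rho> g = mat ?N ?N (\<lambda>(i,j). if e i = g \<otimes> e j then 1 else 0 :: complex)" for g
  have "representation G ?N \<rho>"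
    unfolding representation_iff
  proof (intro conjI ballI)
    show "\<rho> \<one> = 1\<^sub>m ?N" by (intro eq_matI) (auto simp: \<rho>_def ec einj)
    fix g h assume g: "g \<in> carrier G" and h: "h \<in> carrier G"
    show "\<rho> (g \<otimes> h) = \<rho> g * \<rho> h"
    proof (rule eq_matI)
      fix i j assume "i < dim_row (\<rho> g * \<rho> h)" "j < dim_col (\<rho> g * \<rho> h)"
      then have i: "i < ?N" and j: "j < ?N" by (auto simp: \<rho>_def)
      obtain k where k: "k < ?N" "e k = h \<otimes> e j" using esurj[of "h \<otimes> e j"] h ec[OF j] by auto
      have "(\<rho> g * \<rho> h) $$ (i,j) =
          (\<Sum>l=0..<?N. (if e i = g \<otimes> e l then 1 else 0) * (if e l = h \<otimes> e j then 1 else 0))"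
        using i j by (simp add: \<rho>_def scalar_prod_def)
      also have "\<dots> = (\<Sum>l=0..<?N. if l = k then (if e i = g \<otimes> e l then 1 else 0) else 0)"
        using k einj[OF _ k(1)] by (intro sum.cong refl) auto
      also have "\<dots> = (if e i = g \<otimes> e k then 1 else 0)" using k by (simp add: sum.delta)
      also have "\<dots> = \<rho> (g \<otimes> h) $$ (i,j)" using i j g h ec[OF j] by (simp add: \<rho>_def k m_assoc)
      finally show "\<rho> (g \<otimes> h) $$ (i,j) = (\<rho> g * \<rho> h) $$ (i,j)" by simp
    qed (auto simp: \<rho>_def)
  qed (auto simp: \<rho>_def)
  moreover have "mat_trace (\<rho> g) = (if g = \<one> then of_nat ?N else 0)" if g: "g \<in> carrier G" for g
  proof -
    have "e i = g \<otimes> e i \<longleftrightarrow> g = \<one>" if "i < ?N" for i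
      using ec[OF that] g by (metis l_cancel_one r_cancel_one' l_one)
    then have "mat_trace (\<rho> g) = (\<Sum>i<?N. if g = \<one> then 1 else 0)"
      by (auto simp: mat_trace_def \<rho>_def intro!: sum.cong)
    then show ?thesis by simp
  qed
  ultimately show ?thesis by blast
qed

lemma multiplicity_eq_inner_product:
  assumes xs: "set xs \<subseteq> Irr G" and \<psi>: "\<psi> \<in> Irr G"
    and f: "\<And>g. g \<in> carrier G \<Longrightarrow> f g = (\<Sum>\<chi>\<leftarrow>xs. \<chi> g)"
  shows "(\<Sum>g\<in>carrier G. f g * \<psi> (inv g)) = of_nat (count_list xs \<psi>) * of_nat (Coset.order G)"
proof -
  have "(\<Sum>g\<in>carrier G. f g * \<psi> (inv g)) = (\<Sum>g\<in>carrier G. (\<Sum>\<chi>\<leftarrow>xs. \<chi> g) * \<psi> (inv g))"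
    using f by simp
  also have "\<dots> = of_nat (count_list xs \<psi>) * of_nat (Coset.order G)"
    using xs
  proof (induction xs)
    case (Cons \<chi> xs)
    then have "(\<Sum>g\<in>carrier G. \<chi> g * \<psi> (inv g)) = (if \<chi> = \<psi> then of_nat (Coset.order G) else 0)"
      using character_orthogonality[OF _ \<psi>] by simp
    then show ?case using Cons by (auto simp: sum.distrib ring_distribs)
  qed simp
  finally show ?thesis .
qed

text \<open>
  The inner product of the regular character with \<open>\<chi>\<close> has only the term of the identity, so
  \<open>\<chi>\<close> occurs with multiplicity \<open>\<chi> 1\<close>. As this is positive, every irreducible character
  occurs, and there are finitely many of them.
\<close>
lemma regular_character_constituents:
  obtains xs where "set xs = Irr G" "\<And>\<chi>. \<chi> \<in> Irr G \<Longrightarrow> of_nat (count_list xs \<chi>) = \<chi> \<one>"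
    "\<And>g. g \<in> carrier G \<Longrightarrow> (\<Sum>\<chi>\<leftarrow>xs. \<chi> g) = (if g = \<one> then of_nat (Coset.order G) else 0)"
proof -
  obtain \<rho> where \<rho>: "representation G (Coset.order G) \<rho>"
    "\<And>g. g \<in> carrier G \<Longrightarrow> mat_trace (\<rho> g) = (if g = \<one> then of_nat (Coset.order G) else 0)"
    using regular_representation by blast
  obtain xs where xs: "set xs \<subseteq> Irr G" "\<And>g. g \<in> carrier G \<Longrightarrow> mat_trace (\<rho> g) = (\<Sum>\<chi>\<leftarrow>xs. \<chi> g)"
    using representation_trace_is_sum_of_irreducibles[OF \<rho>(1)] by blast
  have cnt: "of_nat (count_list xs \<chi>) = \<chi> \<one>" if \<chi>: "\<chi> \<in> Irr G" for \<chi>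
  proof -
    have "of_nat (count_list xs \<chi>) * of_nat (Coset.order G) = (\<Sum>g\<in>carrier G. mat_trace (\<rho> g) * \<chi> (inv g))"
      using multiplicity_eq_inner_product[OF xs(1) \<chi>, of "\<lambda>g. mat_trace (\<rho> g)"] xs(2) by simp
    also have "\<dots> = (\<Sum>g\<in>carrier G. if g = \<one> then of_nat (Coset.order G) * \<chi> (inv g) else 0)"
      using \<rho>(2) by (intro sum.cong) auto
    also have "\<dots> = of_nat (Coset.order G) * \<chi> \<one>" by (simp add: sum.delta)
    finally show ?thesis using order_pos by simp
  qed
  have "Irr G \<subseteq> set xs"
  proof
    fix \<chi> assume \<chi>: "\<chi> \<in> Irr G"
    obtain \<sigma> n where "irreducible_representation G n \<sigma>" "\<chi> \<one> = of_nat n"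
      using mem_IrrE[OF \<chi>] by metis
    then have "count_list xs \<chi> \<noteq> 0"
      using cnt[OF \<chi>] irreducible_representationD(2)[of n \<sigma>] by auto
    then show "\<chi> \<in> set xs" by (simp add: count_list_0_iff)
  qed
  then show ?thesis using that[of xs] xs \<rho>(2) cnt by auto
qed

lemma finite_Irr [simp]: "finite (Irr G)"
  using regular_character_constituents by (metis finite_set)

lemma regular_character_identity:
  assumes g: "g \<in> carrier G"
  shows "(\<Sum>\<chi>\<in>Irr G. \<chi> \<one> * \<chi> g) = (if g = \<one> then of_nat (Coset.order G) else 0)"
proof -
  obtain xs where xs: "set xs = Irr G" "\<And>\<chi>. \<chi> \<in> Irr G \<Longrightarrow> of_nat (count_list xs \<chi>) = \<chi> \<one>"
    "\<And>g. g \<in> carrier G \<Longrightarrow> (\<Sum>\<chi>\<leftarrow>xs. \<chi> g) = (if g = \<one> then of_nat (Coset.order G) else 0)"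
    by (rule regular_character_constituents) (rule that; assumption)
  have "(\<Sum>\<chi>\<leftarrow>ys. \<chi> g) = (\<Sum>\<chi>\<in>S. of_nat (count_list ys \<chi>) * \<chi> g)" if "set ys \<subseteq> S" "finite S" for ys S
    using that
  proof (induction ys)
    case (Cons \<psi> ys)
    have "(\<Sum>\<chi>\<in>S. of_nat (count_list (\<psi> # ys) \<chi>) * \<chi> g) =
        (\<Sum>\<chi>\<in>S. (if \<chi> = \<psi> then \<chi> g else 0) + of_nat (count_list ys \<chi>) * \<chi> g)"
      by (intro sum.cong) (auto simp: ring_distribs)
    also have "\<dots> = \<psi> g + (\<Sum>\<chi>\<in>S. of_nat (count_list ys \<chi>) * \<chi> g)"
      using Cons.prems by (simp add: sum.distrib sum.delta)
    finally show ?case using Cons by simp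
  qed simp
  from this[of xs "Irr G"] have "(\<Sum>\<chi>\<leftarrow>xs. \<chi> g) = (\<Sum>\<chi>\<in>Irr G. \<chi> \<one> * \<chi> g)"
    using xs by simp
  then show ?thesis using xs(3)[OF g] by simp
qed

section \<open>Kernels, scalars and conjugacy classes\<close>

lemma representation_trivial_if_trace_eq_dim:
  assumes \<rho>: "representation G n \<rho>" and g: "g \<in> carrier G" and tr: "mat_trace (\<rho> g) = of_nat n"
  shows "\<rho> g = 1\<^sub>m n"
proof -
  have r: "\<rho> g \<in> carrier_mat n n" using representation_carrier[OF \<rho> g] .
  have "\<rho> (g [^] k) = \<rho> g ^\<^sub>m k" for k :: nat
  proof (induction k)
    case 0
    then show ?case using representation_one[OF \<rho>] r by simp
  next
    case (Suc k)
    then show ?case using representation_mult[OF \<rho> _ g, of "g [^] k"] g by simp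
  qed
  then have "\<rho> g ^\<^sub>m Coset.order G = 1\<^sub>m n"
    using pow_order_eq_1[OF g] representation_one[OF \<rho>] by metis
  then show ?thesis using finite_order_matrix_trace_eq_dim[OF r order_pos _ tr] by simp
qed

text \<open>
  The sum of the conjugates of \<open>a\<close> acts as a scalar by Schur's lemma, and its trace determines
  the scalar.
\<close>
lemma irreducible_character_convolution:
  assumes \<chi>: "\<chi> \<in> Irr G" and a: "a \<in> carrier G" and h: "h \<in> carrier G"
  shows "\<chi> \<one> * (\<Sum>g\<in>carrier G. \<chi> (h \<otimes> (g \<otimes> a \<otimes> inv g))) = of_nat (Coset.order G) * \<chi> h * \<chi> a"
proof -
  obtain \<rho> n where \<rho>: "irreducible_representation G n \<rho>" "\<And>g. g \<in> carrier G \<Longrightarrow> \<chi> g = mat_trace (\<rho> g)"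
    and n: "\<chi> \<one> = of_nat n"
    using mem_IrrE[OF \<chi>] by metis
  note rep = irreducible_representationD(1)[OF \<rho>(1)]
  have r: "\<rho> g \<in> carrier_mat n n" if "g \<in> carrier G" for g using representation_carrier[OF rep that] .
  define T where "T = sum_mat n n (\<lambda>g. \<rho> g * \<rho> a * \<rho> (inv g)) (carrier G)"
  have Tc: "T \<in> carrier_mat n n" by (simp add: T_def)
  have tc: "\<rho> g * \<rho> a * \<rho> (inv g) \<in> carrier_mat n n" if "g \<in> carrier G" for g
    using r[OF that] r[OF a] r[of "inv g"] that by simp
  have conj: "\<rho> (g \<otimes> a \<otimes> inv g) = \<rho> g * \<rho> a * \<rho> (inv g)" if "g \<in> carrier G" for g
    using that a representation_mult[OF rep] by simp
  obtain c where c: "T = c \<cdot>\<^sub>m 1\<^sub>m n"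
    using schur_scalar[OF \<rho>(1) Tc] averaged_intertwiner[OF rep rep r[OF a]] unfolding T_def by blast
  have "c * of_nat n = mat_trace T" unfolding c by (subst mat_trace_smult[of _ n]) auto
  also have "\<dots> = (\<Sum>g\<in>carrier G. mat_trace (\<rho> g * \<rho> a * \<rho> (inv g)))"
    unfolding T_def by (rule mat_trace_sum_mat) (rule tc)
  also have "\<dots> = (\<Sum>g\<in>carrier G. mat_trace (\<rho> a))"
  proof (intro sum.cong refl)
    fix g assume g: "g \<in> carrier G"
    have "mat_trace (\<rho> g * \<rho> a * \<rho> (inv g)) = mat_trace (\<rho> (inv g) * (\<rho> g * \<rho> a))"
      using g a by (intro mat_trace_comm[of _ n n]) (auto intro!: mult_carrier_mat r)
    also have "\<rho> (inv g) * (\<rho> g * \<rho> a) = \<rho> (inv g \<otimes> (g \<otimes> a))"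
      using representation_mult[OF rep] g a by simp
    also have "inv g \<otimes> (g \<otimes> a) = a" using g a by (simp flip: m_assoc)
    finally show "mat_trace (\<rho> g * \<rho> a * \<rho> (inv g)) = mat_trace (\<rho> a)" .
  qed
  finally have cn: "c * of_nat n = of_nat (Coset.order G) * \<chi> a"
    using \<rho>(2)[OF a] by (simp add: Coset.order_def)
  have "(\<Sum>g\<in>carrier G. \<chi> (h \<otimes> (g \<otimes> a \<otimes> inv g))) = (\<Sum>g\<in>carrier G. mat_trace (\<rho> h * (\<rho> g * \<rho> a * \<rho> (inv g))))"
    using \<rho>(2) representation_mult[OF rep h] conj a h by (intro sum.cong refl) simp
  also have "\<dots> = mat_trace (sum_mat n n (\<lambda>g. \<rho> h * (\<rho> g * \<rho> a * \<rho> (inv g))) (carrier G))"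
    using tc r[OF h] by (intro mat_trace_sum_mat[symmetric]) auto
  also have "sum_mat n n (\<lambda>g. \<rho> h * (\<rho> g * \<rho> a * \<rho> (inv g))) (carrier G) = \<rho> h * T"
    unfolding T_def using tc r[OF h] by (intro mult_sum_mat[symmetric]) auto
  also have "\<rho> h * T = c \<cdot>\<^sub>m \<rho> h" unfolding c using mult_smult_distrib[OF r[OF h] one_carrier_mat] r[OF h] by simp
  also have "mat_trace (c \<cdot>\<^sub>m \<rho> h) = c * \<chi> h" using mat_trace_smult[OF r[OF h]] \<rho>(2)[OF h] by simp
  finally show ?thesis using cn n by (simp add: algebra_simps)
qed

lemma Irr_class_function:
  assumes \<chi>: "\<chi> \<in> Irr G" and g: "g \<in> carrier G" and a: "a \<in> carrier G"
  shows "\<chi> (g \<otimes> a \<otimes> inv g) = \<chi> a"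
proof -
  obtain \<rho> n where \<rho>: "irreducible_representation G n \<rho>" "\<And>g. g \<in> carrier G \<Longrightarrow> \<chi> g = mat_trace (\<rho> g)"
    using mem_IrrE[OF \<chi>] by metis
  note rep = irreducible_representationD(1)[OF \<rho>(1)]
  have r: "\<rho> g \<in> carrier_mat n n" if "g \<in> carrier G" for g using representation_carrier[OF rep that] .
  have "\<chi> (g \<otimes> a \<otimes> inv g) = mat_trace (\<rho> (g \<otimes> a) * \<rho> (inv g))"
    using \<rho>(2) g a representation_mult[OF rep, of "g \<otimes> a" "inv g"] by simp
  also have "\<dots> = mat_trace (\<rho> (inv g) * \<rho> (g \<otimes> a))"
    using r g a by (intro mat_trace_comm[of _ n n]) auto
  also have "\<dots> = \<chi> (inv g \<otimes> (g \<otimes> a))"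
    using \<rho>(2) g a representation_mult[OF rep, of "inv g" "g \<otimes> a"] by simp
  also have "inv g \<otimes> (g \<otimes> a) = a" using g a by (simp flip: m_assoc)
  finally show ?thesis .
qed

lemma conj_class_eq: "x \<in> carrier G \<Longrightarrow> conj_class G x = {g \<otimes> x \<otimes> inv g | g. g \<in> carrier G}"
  by (simp add: conj_class_def orbit_def)

lemma mem_conj_class_self: "x \<in> carrier G \<Longrightarrow> x \<in> conj_class G x"
  by (auto simp: conj_class_eq intro!: exI[of _ \<one>])

lemma conj_class_conjugate:
  assumes x: "x \<in> carrier G" and y: "y \<in> conj_class G x"
  shows "y \<in> carrier G" "conj_class G y = conj_class G x"
proof -
  obtain h where h: "h \<in> carrier G" "y = h \<otimes> x \<otimes> inv h" using y x by (auto simp: conj_class_eq)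
  show yc: "y \<in> carrier G" using h x by simp
  have *: "g \<otimes> y \<otimes> inv g = (g \<otimes> h) \<otimes> x \<otimes> inv (g \<otimes> h)" if "g \<in> carrier G" for g
    using that h x by (simp add: inv_mult_group m_assoc)
  have **: "g \<otimes> x \<otimes> inv g = (g \<otimes> inv h) \<otimes> y \<otimes> inv (g \<otimes> inv h)" if g: "g \<in> carrier G" for g
  proof -
    have "g \<otimes> inv h \<otimes> h = g" using g h by (simp add: m_assoc)
    then show ?thesis using *[of "g \<otimes> inv h"] g h by simp
  qed
  show "conj_class G y = conj_class G x"
    unfolding conj_class_eq[OF x] conj_class_eq[OF yc] using * ** h(1) by (blast intro: m_closed inv_closed)
qed

text \<open>
  The number of elements conjugating \<open>x\<close> to \<open>a\<close> is expressed by the values of the irreducible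
  characters at \<open>x\<close>: sum the convolution identity over \<open>Irr G\<close>, where the regular character
  detects the identity element. For \<open>x = a\<close> the number is positive, hence so it is for
  \<open>x = b\<close>.
\<close>
lemma characters_separate_conj_classes:
  assumes a: "a \<in> carrier G" and b: "b \<in> carrier G" and eq: "\<And>\<chi>. \<chi> \<in> Irr G \<Longrightarrow> \<chi> a = \<chi> b"
  shows "conj_class G a = conj_class G b"
proof -
  have count: "(\<Sum>\<chi>\<in>Irr G. of_nat (Coset.order G) * \<chi> (inv a) * \<chi> x) =
      of_nat (Coset.order G * card {g \<in> carrier G. g \<otimes> x \<otimes> inv g = a})" if x: "x \<in> carrier G" for x
  proof -
    have "(\<Sum>\<chi>\<in>Irr G. of_nat (Coset.order G) * \<chi> (inv a) * \<chi> x) =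
        (\<Sum>\<chi>\<in>Irr G. \<Sum>g\<in>carrier G. \<chi> \<one> * \<chi> (inv a \<otimes> (g \<otimes> x \<otimes> inv g)))"
      using irreducible_character_convolution[OF _ x, of _ "inv a"] a
      by (intro sum.cong refl) (simp add: sum_distrib_left)
    also have "\<dots> = (\<Sum>g\<in>carrier G. \<Sum>\<chi>\<in>Irr G. \<chi> \<one> * \<chi> (inv a \<otimes> (g \<otimes> x \<otimes> inv g)))"
      by (rule sum.swap)
    also have "\<dots> = (\<Sum>g\<in>carrier G. if g \<otimes> x \<otimes> inv g = a then of_nat (Coset.order G) else 0)"
    proof (intro sum.cong refl)
      fix g assume g: "g \<in> carrier G"
      have "inv a \<otimes> (g \<otimes> x \<otimes> inv g) = \<one> \<longleftrightarrow> g \<otimes> x \<otimes> inv g = a"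
        using a g x by (metis inv_closed inv_equality inv_inv l_inv m_closed)
      then show "(\<Sum>\<chi>\<in>Irr G. \<chi> \<one> * \<chi> (inv a \<otimes> (g \<otimes> x \<otimes> inv g))) =
          (if g \<otimes> x \<otimes> inv g = a then of_nat (Coset.order G) else 0)"
        using regular_character_identity[of "inv a \<otimes> (g \<otimes> x \<otimes> inv g)"] a g x by simp
    qed
    also have "\<dots> = of_nat (Coset.order G * card {g \<in> carrier G. g \<otimes> x \<otimes> inv g = a})"
      by (simp add: sum.If_cases Int_def mult.commute)
    finally show ?thesis .
  qed
  have "of_nat (Coset.order G * card {g \<in> carrier G. g \<otimes> a \<otimes> inv g = a}) =
      (of_nat (Coset.order G * card {g \<in> carrier G. g \<otimes> b \<otimes> inv g = a}) :: complex)"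
    unfolding count[OF a, symmetric] count[OF b, symmetric] using eq by (intro sum.cong) auto
  then have "card {g \<in> carrier G. g \<otimes> a \<otimes> inv g = a} = card {g \<in> carrier G. g \<otimes> b \<otimes> inv g = a}"
    using order_pos by (simp flip: of_nat_mult)
  moreover have "card {g \<in> carrier G. g \<otimes> a \<otimes> inv g = a} > 0"
    using a by (subst card_gt_0_iff) (auto intro!: exI[of _ \<one>])
  ultimately obtain g where "g \<in> carrier G" "g \<otimes> b \<otimes> inv g = a"
    by (metis (mono_tags, lifting) card.empty empty_Collect_eq less_numeral_extra(3))
  then have "a \<in> conj_class G b" using b by (auto simp: conj_class_eq)
  then show ?thesis using conj_class_conjugate[OF b] by blast
qed

lemma Irr_degree:
  assumes "\<chi> \<in> Irr G"
  shows "\<exists>d::nat. 0 < d \<and> \<chi> \<one> = of_nat d"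
  using mem_IrrE[OF assms] irreducible_representationD(2) by metis

lemma Irr_degree_nonzero: "\<chi> \<in> Irr G \<Longrightarrow> \<chi> \<one> \<noteq> 0"
  using Irr_degree by fastforce

text \<open>
  An element at which the character takes its degree is represented by the identity matrix.
\<close>
lemma Irr_kernel_mult:
  assumes \<chi>: "\<chi> \<in> Irr G" and g: "g \<in> carrier G" and h: "h \<in> carrier G" and ker: "\<chi> g = \<chi> \<one>"
  shows "\<chi> (g \<otimes> h) = \<chi> h"
proof -
  obtain \<rho> n where \<rho>: "irreducible_representation G n \<rho>" "\<And>g. g \<in> carrier G \<Longrightarrow> \<chi> g = mat_trace (\<rho> g)"
    and n: "\<chi> \<one> = of_nat n"
    using mem_IrrE[OF \<chi>] by metis
  note rep = irreducible_representationD(1)[OF \<rho>(1)]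
  have "\<rho> g = 1\<^sub>m n"
    using representation_trivial_if_trace_eq_dim[OF rep g] \<rho>(2)[OF g] ker n by simp
  then show ?thesis
    using \<rho>(2) g h representation_mult[OF rep g h] representation_carrier[OF rep h] by simp
qed

text \<open>
  The sum is \<open>card H\<close> times the multiplicity of the principal character of \<open>H\<close> in the restriction
  of \<open>\<chi>\<close>. This integrality drives the argument with Sylow subgroups.
\<close>
lemma Irr_sum_over_subgroup:
  assumes \<chi>: "\<chi> \<in> Irr G" and H: "subgroup H G"
  shows "\<exists>k::nat. (\<Sum>x\<in>H. \<chi> x) = of_nat (k * card H)"
proof -
  let ?H = "G\<lparr>carrier := H\<rparr>"
  have Hc: "H \<subseteq> carrier G" using subgroup.subset[OF H] .
  interpret H: finite_group ?H
    using subgroup_imp_group[OF H] finite_subset[OF Hc finite_carrier]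
    by (simp add: finite_group_def finite_group_axioms_def)
  obtain \<rho> n where \<rho>: "irreducible_representation G n \<rho>" "\<And>g. g \<in> carrier G \<Longrightarrow> \<chi> g = mat_trace (\<rho> g)"
    using mem_IrrE[OF \<chi>] by metis
  have "representation ?H n \<rho>"
    using irreducible_representationD(1)[OF \<rho>(1)] Hc
    unfolding representation_iff H.representation_iff by auto
  then obtain xs where xs: "set xs \<subseteq> Irr ?H" "\<forall>g\<in>carrier ?H. mat_trace (\<rho> g) = (\<Sum>\<chi>\<leftarrow>xs. \<chi> g)"
    using H.representation_trace_is_sum_of_irreducibles by blast
  let ?p = "principal_character ?H"
  have "(\<Sum>x\<in>H. \<chi> x) = (\<Sum>x\<in>carrier ?H. mat_trace (\<rho> x) * ?p (inv\<^bsub>?H\<^esub> x))"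
    using \<rho>(2) Hc H.inv_closed by (intro sum.cong) (auto simp: principal_character_def)
  also have "\<dots> = of_nat (count_list xs ?p) * of_nat (Coset.order ?H)"
    by (rule H.multiplicity_eq_inner_product[OF xs(1) H.principal_character_in_Irr]) (use xs(2) in auto)
  finally show ?thesis by (intro exI[of _ "count_list xs ?p"]) (simp add: Coset.order_def)
qed

lemma Irr_scalar_on_center:
  assumes \<chi>: "\<chi> \<in> Irr G" and z: "z \<in> center G"
  obtains c where "c \<noteq> 0" "\<And>g. g \<in> carrier G \<Longrightarrow> \<chi> (z \<otimes> g) = c * \<chi> g"
proof -
  obtain \<rho> n where \<rho>: "irreducible_representation G n \<rho>" "\<And>g. g \<in> carrier G \<Longrightarrow> \<chi> g = mat_trace (\<rho> g)"
    using mem_IrrE[OF \<chi>] by metis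
  note rep = irreducible_representationD(1)[OF \<rho>(1)]
  have zc: "z \<in> carrier G" and zcomm: "\<And>g. g \<in> carrier G \<Longrightarrow> z \<otimes> g = g \<otimes> z"
    using z by (auto simp: center_def)
  have r: "\<rho> g \<in> carrier_mat n n" if "g \<in> carrier G" for g using representation_carrier[OF rep that] .
  obtain c where c: "\<rho> z = c \<cdot>\<^sub>m 1\<^sub>m n"
    using schur_scalar[OF \<rho>(1) r[OF zc]] representation_mult[OF rep] zc zcomm by metis
  have *: "\<chi> (z \<otimes> g) = c * \<chi> g" if g: "g \<in> carrier G" for g
  proof -
    have "\<rho> (z \<otimes> g) = c \<cdot>\<^sub>m \<rho> g"
      using representation_mult[OF rep zc g] c mult_smult_assoc_mat[OF one_carrier_mat r[OF g]] r[OF g] by simp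
    then show ?thesis using \<rho>(2) zc g mat_trace_smult[OF r[OF g]] by simp
  qed
  have "c \<noteq> 0"
  proof
    assume "c = 0"
    then have "\<chi> \<one> = 0" using *[of "inv z"] zc by simp
    then show False using Irr_degree_nonzero[OF \<chi>] by simp
  qed
  then show ?thesis using that * by blast
qed

lemma Irr_degree_square_sum: "(\<Sum>\<chi>\<in>Irr G. \<chi> \<one> * \<chi> \<one>) = of_nat (Coset.order G)"
  using regular_character_identity[of \<one>] by simp

lemma subgroup_center: "subgroup (center G) G"
proof (rule subgroupI)
  fix a assume a: "a \<in> center G"
  have "inv a \<otimes> g = g \<otimes> inv a" if g: "g \<in> carrier G" for g
  proof -
    have "a \<otimes> inv g = inv g \<otimes> a" using a g by (simp add: center_def)
    then have "inv (a \<otimes> inv g) = inv (inv g \<otimes> a)" by simp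
    moreover have "a \<in> carrier G" using a by (simp add: center_def)
    ultimately show ?thesis using g by (simp add: inv_mult_group)
  qed
  then show "inv a \<in> center G" using a by (auto simp: center_def)
next
  fix a b assume a: "a \<in> center G" and b: "b \<in> center G"
  have ac: "a \<in> carrier G" and bc: "b \<in> carrier G" using a b by (simp_all add: center_def)
  have "a \<otimes> b \<otimes> g = g \<otimes> (a \<otimes> b)" if g: "g \<in> carrier G" for g
  proof -
    have "a \<otimes> b \<otimes> g = a \<otimes> (b \<otimes> g)" using ac bc g by (rule m_assoc)
    also have "b \<otimes> g = g \<otimes> b" using b g by (simp add: center_def)
    also have "a \<otimes> (g \<otimes> b) = a \<otimes> g \<otimes> b" using m_assoc[OF ac g bc] by simp
    also have "a \<otimes> g = g \<otimes> a" using a g by (simp add: center_def)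
    finally show ?thesis using m_assoc[OF g ac bc] by simp
  qed
  then show "a \<otimes> b \<in> center G" using ac bc by (simp add: center_def)
qed (auto simp: center_def)

lemma conj_class_central: "z \<in> center G \<Longrightarrow> conj_class G z = {z}"
proof -
  assume z: "z \<in> center G"
  then have zc: "z \<in> carrier G" by (simp add: center_def)
  have "g \<otimes> z \<otimes> inv g = z" if "g \<in> carrier G" for g
  proof -
    have "g \<otimes> z = z \<otimes> g" using z that by (simp add: center_def)
    then show ?thesis using zc that by (simp add: m_assoc)
  qed
  then show ?thesis unfolding conj_class_eq[OF zc] by (auto intro!: exI[of _ \<one>] simp: zc)
qed

lemma columns_differ_once_sym: "columns_differ_once G a b \<Longrightarrow> columns_differ_once G b a"
  unfolding columns_differ_once_def by (metis)

text \<open>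
  Away from the identity the regular character vanishes at both elements, and its two values
  differ by the single term of \<open>\<chi>\<close>.
\<close>
lemma columns_differ_once_imp_one:
  assumes "columns_differ_once G a b"
  shows "a = \<one> \<or> b = \<one>"
proof (rule ccontr)
  assume ne: "\<not> (a = \<one> \<or> b = \<one>)"
  have a: "a \<in> carrier G" and b: "b \<in> carrier G" using assms by (auto simp: columns_differ_once_def)
  obtain \<chi> where \<chi>: "\<chi> \<in> Irr G" "\<chi> a \<noteq> \<chi> b" "\<And>\<psi>. \<psi> \<in> Irr G - {\<chi>} \<Longrightarrow> \<psi> a = \<psi> b"
    using assms by (auto simp: columns_differ_once_def)
  have "0 = (\<Sum>\<psi>\<in>Irr G. \<psi> \<one> * \<psi> a) - (\<Sum>\<psi>\<in>Irr G. \<psi> \<one> * \<psi> b)"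
    using regular_character_identity[OF a] regular_character_identity[OF b] ne by simp
  also have "\<dots> = (\<Sum>\<psi>\<in>Irr G. \<psi> \<one> * (\<psi> a - \<psi> b))"
    by (simp add: sum_subtractf ring_distribs)
  also have "\<dots> = \<chi> \<one> * (\<chi> a - \<chi> b) + (\<Sum>\<psi>\<in>Irr G - {\<chi>}. \<psi> \<one> * (\<psi> a - \<psi> b))"
    by (rule sum.remove[OF finite_Irr \<chi>(1)])
  also have "(\<Sum>\<psi>\<in>Irr G - {\<chi>}. \<psi> \<one> * (\<psi> a - \<psi> b)) = 0"
    using \<chi>(3) by (intro sum.neutral ballI) (metis diff_self mult_zero_right)
  finally show False using Irr_degree_nonzero[OF \<chi>(1)] \<chi>(2) by simp
qed

end

section \<open>A column that differs from the degrees in one entry\<close>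

lemma power_of_two_if_no_odd_prime_divisor:
  fixes n :: nat
  assumes n: "n \<noteq> 0" and p: "\<And>p. Factorial_Ring.prime p \<Longrightarrow> p dvd n \<Longrightarrow> p = 2"
  shows "\<exists>m. n = 2 ^ m"
proof -
  obtain m where m: "n = 2 ^ multiplicity 2 n * m" "\<not> 2 dvd m"
    using multiplicity_decompose'[of n 2] n by auto
  have "m = 1"
  proof (rule ccontr)
    assume "m \<noteq> 1"
    then obtain q where q: "Factorial_Ring.prime q" "q dvd m" using prime_factor_nat by blast
    then have "q = 2" using p m(1) by (metis dvd_mult)
    then show False using q m(2) by simp
  qed
  then show ?thesis using m(1) by auto
qed

text \<open>
  The situation of two columns that differ once, after one of them has been recognised as the
  column of the identity. The row \<open>\<chi>\<close> is a parameter, so that two instances can be compared.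
\<close>
locale exceptional_column = finite_group +
  fixes \<chi> :: "'a \<Rightarrow> complex" and b :: 'a
  assumes chi_Irr: "\<chi> \<in> Irr G" and b_carrier: "b \<in> carrier G"
    and chi_b: "\<chi> b \<noteq> \<chi> \<one>"
    and others_b: "\<And>\<psi>. \<psi> \<in> Irr G \<Longrightarrow> \<psi> \<noteq> \<chi> \<Longrightarrow> \<psi> b = \<psi> \<one>"

lemma (in finite_group) exceptional_column_if_columns_differ:
  assumes "columns_differ_once G \<one> b"
  shows "\<exists>\<chi>. exceptional_column G \<chi> b"
proof -
  obtain \<chi> where \<chi>: "b \<in> carrier G" "\<chi> \<in> Irr G" "\<chi> \<one> \<noteq> \<chi> b" "\<And>\<psi>. \<psi> \<in> Irr G - {\<chi>} \<Longrightarrow> \<psi> \<one> = \<psi> b"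
    using assms by (auto simp: columns_differ_once_def)
  have "\<psi> b = \<psi> \<one>" if "\<psi> \<in> Irr G" "\<psi> \<noteq> \<chi>" for \<psi> using \<chi>(4)[of \<psi>] that by simp
  then have "exceptional_column G \<chi> b" using \<chi>(1-3) by unfold_locales auto
  then show ?thesis by blast
qed

context exceptional_column
begin

text \<open>
  The intersection of the kernels of the other irreducible characters, the kernel of a
  character being the set where it takes its degree.
\<close>
definition others_kernel :: "'a set" where
  "others_kernel = {g \<in> carrier G. \<forall>\<psi>\<in>Irr G - {\<chi>}. \<psi> g = \<psi> \<one>}"

lemma others_kernelD:
  "g \<in> others_kernel \<Longrightarrow> g \<in> carrier G"
  "g \<in> others_kernel \<Longrightarrow> \<psi> \<in> Irr G \<Longrightarrow> \<psi> \<noteq> \<chi> \<Longrightarrow> \<psi> g = \<psi> \<one>"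
  by (auto simp: others_kernel_def)

lemma b_in_kernel: "b \<in> others_kernel"
  using b_carrier others_b by (auto simp: others_kernel_def)

lemma b_neq_one: "b \<noteq> \<one>"
  using chi_b by auto

lemma subgroup_others_kernel: "subgroup others_kernel G"
proof (rule subgroupI)
  show "others_kernel \<subseteq> carrier G" by (auto simp: others_kernel_def)
  show "others_kernel \<noteq> {}" using b_in_kernel by auto
  fix g assume g: "g \<in> others_kernel"
  then have gc: "g \<in> carrier G" by (simp add: others_kernel_def)
  have "\<psi> (inv g) = \<psi> \<one>" if "\<psi> \<in> Irr G" "\<psi> \<noteq> \<chi>" for \<psi>
    using Irr_kernel_mult[OF that(1) gc, of "inv g"] others_kernelD(2)[OF g that] gc by simp
  then show "inv g \<in> others_kernel" using gc by (auto simp: others_kernel_def)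
  fix h assume h: "h \<in> others_kernel"
  then have hc: "h \<in> carrier G" by (simp add: others_kernel_def)
  have "\<psi> (g \<otimes> h) = \<psi> \<one>" if "\<psi> \<in> Irr G" "\<psi> \<noteq> \<chi>" for \<psi>
    using Irr_kernel_mult[OF that(1) gc hc] others_kernelD(2)[OF g that] others_kernelD(2)[OF h that] by simp
  then show "g \<otimes> h \<in> others_kernel" using gc hc by (auto simp: others_kernel_def)
qed

lemma finite_others_kernel [simp]: "finite others_kernel"
  by (rule finite_subset[OF _ finite_carrier]) (auto simp: others_kernel_def)

lemma conjugate_in_others_kernel:
  assumes g: "g \<in> carrier G" and x: "x \<in> others_kernel"
  shows "g \<otimes> x \<otimes> inv g \<in> others_kernel"
proof -
  have xc: "x \<in> carrier G" using others_kernelD(1)[OF x] .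
  have "\<psi> (g \<otimes> x \<otimes> inv g) = \<psi> \<one>" if "\<psi> \<in> Irr G" "\<psi> \<noteq> \<chi>" for \<psi>
    using Irr_class_function[OF that(1) g xc] others_kernelD(2)[OF x that] by simp
  then show ?thesis using g xc by (auto simp: others_kernel_def)
qed

text \<open>
  Subtract the regular identities at \<open>1\<close> and at \<open>g\<close>: only the term of \<open>\<chi>\<close> survives.
\<close>
lemma others_kernel_value:
  assumes g: "g \<in> others_kernel" and g1: "g \<noteq> \<one>"
  shows "\<chi> \<one> * (\<chi> \<one> - \<chi> g) = of_nat (Coset.order G)"
proof -
  have gc: "g \<in> carrier G" using others_kernelD(1)[OF g] .
  have "of_nat (Coset.order G) = (\<Sum>\<psi>\<in>Irr G. \<psi> \<one> * \<psi> \<one>) - (\<Sum>\<psi>\<in>Irr G. \<psi> \<one> * \<psi> g)"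
    using Irr_degree_square_sum regular_character_identity[OF gc] g1 by simp
  also have "\<dots> = (\<Sum>\<psi>\<in>Irr G. \<psi> \<one> * (\<psi> \<one> - \<psi> g))"
    by (simp add: sum_subtractf ring_distribs)
  also have "\<dots> = \<chi> \<one> * (\<chi> \<one> - \<chi> g) + (\<Sum>\<psi>\<in>Irr G - {\<chi>}. \<psi> \<one> * (\<psi> \<one> - \<psi> g))"
    by (rule sum.remove[OF finite_Irr chi_Irr])
  also have "(\<Sum>\<psi>\<in>Irr G - {\<chi>}. \<psi> \<one> * (\<psi> \<one> - \<psi> g)) = 0"
  proof (intro sum.neutral ballI)
    fix \<psi> assume "\<psi> \<in> Irr G - {\<chi>}"
    then have "\<psi> g = \<psi> \<one>" using others_kernelD(2)[OF g] by blast
    then show "\<psi> \<one> * (\<psi> \<one> - \<psi> g) = 0" by simp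
  qed
  finally show ?thesis by simp
qed

lemma others_kernel_value_eq_b:
  assumes "g \<in> others_kernel" "g \<noteq> \<one>"
  shows "\<chi> g = \<chi> b"
proof -
  have "\<chi> \<one> * (\<chi> \<one> - \<chi> g) = \<chi> \<one> * (\<chi> \<one> - \<chi> b)"
    using others_kernel_value[OF assms] others_kernel_value[OF b_in_kernel b_neq_one] by simp
  then show ?thesis using Irr_degree_nonzero[OF chi_Irr] by simp
qed

text \<open>
  The sum \<open>M\<close> of the matrices of \<open>others_kernel\<close> commutes with the representation because the
  subgroup is normal, so it is a scalar; but it absorbs the matrix of \<open>b\<close>, whose trace
  is not the degree, so the scalar is zero.
\<close>
lemma coset_sum_zero:
  assumes g: "g \<in> carrier G"
  shows "(\<Sum>x\<in>others_kernel. \<chi> (x \<otimes> g)) = 0"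
proof -
  obtain \<rho> n where \<rho>: "irreducible_representation G n \<rho>" "\<And>g. g \<in> carrier G \<Longrightarrow> \<chi> g = mat_trace (\<rho> g)"
    and n: "\<chi> \<one> = of_nat n"
    using mem_IrrE[OF chi_Irr] by metis
  note rep = irreducible_representationD(1)[OF \<rho>(1)]
  have r: "\<rho> g \<in> carrier_mat n n" if "g \<in> carrier G" for g using representation_carrier[OF rep that] .
  have Nc: "x \<in> carrier G" if "x \<in> others_kernel" for x using others_kernelD(1)[OF that] .
  define M where "M = sum_mat n n \<rho> others_kernel"
  have M: "M \<in> carrier_mat n n" by (simp add: M_def)
  have left: "\<rho> h * M = sum_mat n n (\<lambda>x. \<rho> (h \<otimes> x)) others_kernel" if h: "h \<in> carrier G" for h
  proof -
    have "\<rho> h * M = sum_mat n n (\<lambda>x. \<rho> h * \<rho> x) others_kernel"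
      unfolding M_def using r Nc h by (intro mult_sum_mat) auto
    also have "\<dots> = sum_mat n n (\<lambda>x. \<rho> (h \<otimes> x)) others_kernel"
      using representation_mult[OF rep h] Nc by (intro sum_mat_cong) simp
    finally show ?thesis .
  qed
  have right: "M * \<rho> h = sum_mat n n (\<lambda>x. \<rho> (x \<otimes> h)) others_kernel" if h: "h \<in> carrier G" for h
  proof -
    have "M * \<rho> h = sum_mat n n (\<lambda>x. \<rho> x * \<rho> h) others_kernel"
      unfolding M_def using r Nc h by (intro sum_mat_mult) auto
    also have "\<dots> = sum_mat n n (\<lambda>x. \<rho> (x \<otimes> h)) others_kernel"
      using representation_mult[OF rep _ h] Nc by (intro sum_mat_cong) simp
    finally show ?thesis .
  qed
  have "\<rho> h * M = M * \<rho> h" if h: "h \<in> carrier G" for h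
  proof -
    have "bij_betw (\<lambda>x. h \<otimes> x \<otimes> inv h) others_kernel others_kernel"
    proof (rule bij_betwI[where g = "\<lambda>x. inv h \<otimes> x \<otimes> h"])
      show "(\<lambda>x. h \<otimes> x \<otimes> inv h) \<in> others_kernel \<rightarrow> others_kernel"
        using conjugate_in_others_kernel[OF h] by auto
      show "(\<lambda>x. inv h \<otimes> x \<otimes> h) \<in> others_kernel \<rightarrow> others_kernel"
        using conjugate_in_others_kernel[of "inv h"] h by auto
    next
      fix x assume "x \<in> others_kernel"
      then have x: "x \<in> carrier G" by (rule Nc)
      have "inv h \<otimes> (h \<otimes> x \<otimes> inv h) \<otimes> h = (inv h \<otimes> h) \<otimes> x \<otimes> (inv h \<otimes> h)"
        using x h by (simp only: m_assoc m_closed inv_closed)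
      then show "inv h \<otimes> (h \<otimes> x \<otimes> inv h) \<otimes> h = x" using x h by simp
      have "h \<otimes> (inv h \<otimes> x \<otimes> h) \<otimes> inv h = (h \<otimes> inv h) \<otimes> x \<otimes> (h \<otimes> inv h)"
        using x h by (simp only: m_assoc m_closed inv_closed)
      then show "h \<otimes> (inv h \<otimes> x \<otimes> h) \<otimes> inv h = x" using x h by simp
    qed
    from sum_mat_reindex[OF this, of n n "\<lambda>x. \<rho> (x \<otimes> h)"]
    have "M * \<rho> h = sum_mat n n (\<lambda>x. \<rho> (h \<otimes> x \<otimes> inv h \<otimes> h)) others_kernel"
      unfolding right[OF h] .
    also have "\<dots> = sum_mat n n (\<lambda>x. \<rho> (h \<otimes> x)) others_kernel"
      using h Nc by (intro sum_mat_cong) (simp add: m_assoc)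
    finally show ?thesis using left[OF h] by simp
  qed
  then obtain c where c: "M = c \<cdot>\<^sub>m 1\<^sub>m n" using schur_scalar[OF \<rho>(1) M] by blast
  have "bij_betw (\<lambda>x. b \<otimes> x) others_kernel others_kernel"
  proof (rule bij_betwI[where g = "\<lambda>x. inv b \<otimes> x"])
    show "(\<lambda>x. b \<otimes> x) \<in> others_kernel \<rightarrow> others_kernel" "(\<lambda>x. inv b \<otimes> x) \<in> others_kernel \<rightarrow> others_kernel"
      using subgroup.m_closed[OF subgroup_others_kernel] subgroup.m_inv_closed[OF subgroup_others_kernel] b_in_kernel
      by auto
  qed (use Nc b_carrier in \<open>auto simp flip: m_assoc\<close>)
  from sum_mat_reindex[OF this, of n n \<rho>] have "\<rho> b * M = M"
    unfolding left[OF b_carrier] by (simp add: M_def)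
  moreover have "\<rho> b * M = c \<cdot>\<^sub>m \<rho> b"
    unfolding c using mult_smult_distrib[OF r[OF b_carrier] one_carrier_mat] r[OF b_carrier] by simp
  ultimately have "mat_trace (c \<cdot>\<^sub>m \<rho> b) = mat_trace (c \<cdot>\<^sub>m (1\<^sub>m n :: complex mat))" using c by simp
  then have "c * \<chi> b = c * \<chi> \<one>"
    using mat_trace_smult[OF r[OF b_carrier], of c] mat_trace_smult[of "1\<^sub>m n :: complex mat" n c] \<rho>(2)[OF b_carrier] n by simp
  then have "c = 0" using chi_b by simp
  have "(\<Sum>x\<in>others_kernel. \<chi> (x \<otimes> g)) = (\<Sum>x\<in>others_kernel. mat_trace (\<rho> (x \<otimes> g)))"
    using \<rho>(2) Nc g by (intro sum.cong) auto
  also have "\<dots> = mat_trace (M * \<rho> g)"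
    unfolding right[OF g] using r Nc g by (intro mat_trace_sum_mat[symmetric]) auto
  also have "M * \<rho> g = 0 \<cdot>\<^sub>m \<rho> g"
    unfolding c \<open>c = 0\<close> using mult_smult_assoc_mat[OF one_carrier_mat r[OF g]] r[OF g] by simp
  also have "mat_trace (0 \<cdot>\<^sub>m \<rho> g) = 0" using mat_trace_smult[OF r[OF g]] by simp
  finally show ?thesis .
qed

lemma card_others_kernel_ge_2: "2 \<le> card others_kernel"
proof -
  have "{\<one>, b} \<subseteq> others_kernel"
    using b_in_kernel subgroup.one_closed[OF subgroup_others_kernel] by simp
  from card_mono[OF finite_others_kernel this] show ?thesis using b_neq_one by simp
qed

text \<open>
  The sum over \<open>others_kernel\<close> is zero, and all nonidentity elements contribute the value at \<open>b\<close>.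
\<close>
lemma value_at_b: "(of_nat (card others_kernel) - 1) * \<chi> b = - \<chi> \<one>"
proof -
  have one: "\<one> \<in> others_kernel" by (rule subgroup.one_closed[OF subgroup_others_kernel])
  have "0 = (\<Sum>x\<in>others_kernel. \<chi> x)"
    using coset_sum_zero[of \<one>] others_kernelD(1) by simp
  also have "\<dots> = \<chi> \<one> + (\<Sum>x\<in>others_kernel - {\<one>}. \<chi> x)"
    by (rule sum.remove[OF finite_others_kernel one])
  also have "(\<Sum>x\<in>others_kernel - {\<one>}. \<chi> x) = (\<Sum>x\<in>others_kernel - {\<one>}. \<chi> b)"
    by (intro sum.cong) (auto intro: others_kernel_value_eq_b)
  also have "\<dots> = (of_nat (card others_kernel) - 1) * \<chi> b"
    using one card_others_kernel_ge_2 by (simp add: card_Diff_singleton of_nat_diff)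
  finally show ?thesis by (simp add: eq_neg_iff_add_eq_0 add.commute)
qed

text \<open>
  Combines \<open>value_at_b\<close> with the regular identity at \<open>b\<close>; stated in natural numbers for the
  divisibility arguments.
\<close>
lemma order_eq_degree:
  assumes d: "\<chi> \<one> = of_nat d"
  shows "Coset.order G * (card others_kernel - 1) = d ^ 2 * card others_kernel"
proof -
  let ?c = "of_nat (card others_kernel) :: complex"
  have "of_nat (Coset.order G) * (?c - 1) = of_nat d * (of_nat d * (?c - 1) - (?c - 1) * \<chi> b)"
    unfolding others_kernel_value[OF b_in_kernel b_neq_one, symmetric] d by (simp add: algebra_simps)
  also have "\<dots> = of_nat d * of_nat d * ?c"
    unfolding value_at_b d by (simp add: algebra_simps)
  finally have "(of_nat (Coset.order G * (card others_kernel - 1)) :: complex) = of_nat (d ^ 2 * card others_kernel)"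
    using card_others_kernel_ge_2 by (simp add: of_nat_diff power2_eq_square)
  then show ?thesis using of_nat_eq_iff by blast
qed

lemma not_principal: "\<chi> \<noteq> principal_character G"
  using chi_b b_carrier by (auto simp: principal_character_def)

text \<open>
  The square of the degree of \<open>\<chi>\<close> is at least half the group order. A second character of at
  least this degree would, together with the principal character, exceed the sum of the squares
  of all degrees. If the second character is the principal one, then a degree \<open>1\<close> of \<open>\<chi>\<close>
  is excluded by \<open>|G| > 2\<close>.
\<close>
lemma degree_maximal:
  assumes G2: "2 < Coset.order G" and \<psi>: "\<psi> \<in> Irr G" "\<psi> \<noteq> \<chi>"
  shows "Re (\<psi> \<one>) < Re (\<chi> \<one>)"
proof -
  obtain d where d: "0 < d" "\<chi> \<one> = of_nat d" using Irr_degree[OF chi_Irr] by blast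
  obtain e where e: "0 < e" "\<psi> \<one> = of_nat e" using Irr_degree[OF \<psi>(1)] by blast
  \<comment> \<open>For \<open>c \<ge> 2\<close>, here the cardinality of \<open>others_kernel\<close>, \<open>c \<le> 2 * (c - 1)\<close>.\<close>
  have "Coset.order G * (card others_kernel - 1) \<le> (2 * d ^ 2) * (card others_kernel - 1)"
    unfolding order_eq_degree[OF d(2)] using card_others_kernel_ge_2
    by (simp add: mult.commute mult.left_commute) (auto simp: algebra_simps intro!: mult_le_mono)
  then have le: "Coset.order G \<le> 2 * d ^ 2" using card_others_kernel_ge_2 by simp
  have "e < d"
  proof (cases "\<psi> = principal_character G")
    case True
    then have "e = 1" using e(2) by (simp add: principal_character_def)
    moreover have "d \<noteq> 1" using le G2 by auto
    ultimately show ?thesis using d(1) by simp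
  next
    case False
    obtain deg where deg: "\<And>\<phi>. \<phi> \<in> Irr G \<Longrightarrow> \<phi> \<one> = of_nat (deg \<phi>)"
      using Irr_degree by metis
    have "(\<Sum>\<phi>\<in>Irr G. \<phi> \<one> * \<phi> \<one>) = of_nat (\<Sum>\<phi>\<in>Irr G. deg \<phi> * deg \<phi>)"
      using deg by simp
    then have total: "(\<Sum>\<phi>\<in>Irr G. deg \<phi> * deg \<phi>) = Coset.order G"
      using Irr_degree_square_sum by (metis of_nat_eq_iff)
    have "(\<Sum>\<phi>\<in>{principal_character G, \<psi>, \<chi>}. deg \<phi> * deg \<phi>) \<le> (\<Sum>\<phi>\<in>Irr G. deg \<phi> * deg \<phi>)"
      using principal_character_in_Irr \<psi>(1) chi_Irr by (intro sum_mono2) auto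
    moreover have "deg \<chi> = d" "deg \<psi> = e" "deg (principal_character G) = 1"
      using deg[OF chi_Irr] d deg[OF \<psi>(1)] e deg[OF principal_character_in_Irr]
      by (simp_all add: principal_character_def)
    ultimately have "1 + e * e + d * d \<le> Coset.order G"
      using False \<psi>(2) not_principal total by auto
    then have "e * e < d * d" using le by (simp add: power2_eq_square)
    then show ?thesis by (meson linorder_not_less mult_le_mono)
  qed
  then show ?thesis using d e by simp
qed

text \<open>
  Both \<open>g\<close> and \<open>x \<otimes> g\<close> differ from the identity, and the other characters do not distinguish
  them; so by the regular identity neither does \<open>\<chi>\<close>. Hence \<open>\<chi>\<close> is constant on the coset
  of \<open>g\<close>, over which it sums to zero.
\<close>
lemma vanishes_off_others_kernel:
  assumes g: "g \<in> carrier G" "g \<notin> others_kernel"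
  shows "\<chi> g = 0"
proof -
  have "\<chi> (x \<otimes> g) = \<chi> g" if x: "x \<in> others_kernel" for x
  proof -
    have xc: "x \<in> carrier G" using others_kernelD(1)[OF x] .
    have g1: "g \<noteq> \<one>" using g subgroup.one_closed[OF subgroup_others_kernel] by auto
    have xg1: "x \<otimes> g \<noteq> \<one>"
      using g x xc subgroup.m_inv_closed[OF subgroup_others_kernel x] by (metis inv_equality inv_inv)
    have "0 = (\<Sum>\<psi>\<in>Irr G. \<psi> \<one> * \<psi> (x \<otimes> g)) - (\<Sum>\<psi>\<in>Irr G. \<psi> \<one> * \<psi> g)"
      using regular_character_identity[of g] regular_character_identity[of "x \<otimes> g"] g1 xg1 g xc by simp
    also have "\<dots> = (\<Sum>\<psi>\<in>Irr G. \<psi> \<one> * (\<psi> (x \<otimes> g) - \<psi> g))"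
      by (simp add: sum_subtractf ring_distribs)
    also have "\<dots> = \<chi> \<one> * (\<chi> (x \<otimes> g) - \<chi> g) + (\<Sum>\<psi>\<in>Irr G - {\<chi>}. \<psi> \<one> * (\<psi> (x \<otimes> g) - \<psi> g))"
      by (rule sum.remove[OF finite_Irr chi_Irr])
    also have "(\<Sum>\<psi>\<in>Irr G - {\<chi>}. \<psi> \<one> * (\<psi> (x \<otimes> g) - \<psi> g)) = 0"
      using Irr_kernel_mult[OF _ xc g(1)] others_kernelD(2)[OF x] by (intro sum.neutral) auto
    finally show ?thesis using Irr_degree_nonzero[OF chi_Irr] by simp
  qed
  then have "of_nat (card others_kernel) * \<chi> g = 0"
    using coset_sum_zero[OF g(1)] by simp
  then show ?thesis using card_others_kernel_ge_2 by auto
qed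

text \<open>
  Central elements act as nonzero scalars, so \<open>\<chi>\<close> does not vanish there.
\<close>
lemma center_subset_others_kernel: "center G \<subseteq> others_kernel"
proof
  fix z assume z: "z \<in> center G"
  then have zc: "z \<in> carrier G" by (simp add: center_def)
  obtain c where c: "c \<noteq> 0" "\<And>g. g \<in> carrier G \<Longrightarrow> \<chi> (z \<otimes> g) = c * \<chi> g"
    using Irr_scalar_on_center[OF chi_Irr z] by blast
  have "\<chi> z \<noteq> 0" using c(2)[of \<one>] c(1) zc Irr_degree_nonzero[OF chi_Irr] by simp
  then show "z \<in> others_kernel" using vanishes_off_others_kernel[OF zc] by blast
qed

lemma columns_differ_once_one_b: "columns_differ_once G \<one> b"
proof -
  have "conj_class G \<one> = {\<one>}" by (rule conj_class_central) (simp add: center_def)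
  then have "conj_class G \<one> \<noteq> conj_class G b"
    using mem_conj_class_self[OF b_carrier] b_neq_one by auto
  then show ?thesis
    unfolding columns_differ_once_def using b_carrier chi_Irr chi_b others_b
    by (intro conjI bexI[of _ \<chi>]) (auto dest: not_sym)
qed

lemma exceptional_column_conjugate:
  assumes "b' \<in> conj_class G b"
  shows "exceptional_column G \<chi> b'"
proof -
  obtain g where g: "g \<in> carrier G" "b' = g \<otimes> b \<otimes> inv g"
    using assms by (auto simp: conj_class_eq[OF b_carrier])
  have eq: "\<psi> b' = \<psi> b" if "\<psi> \<in> Irr G" for \<psi>
    unfolding g(2) using Irr_class_function[OF that g(1) b_carrier] .
  show ?thesis
  proof
    show "\<chi> \<in> Irr G" by (rule chi_Irr)
    show "b' \<in> carrier G" using g b_carrier by simp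
    show "\<chi> b' \<noteq> \<chi> \<one>" using eq[OF chi_Irr] chi_b by simp
    show "\<psi> b' = \<psi> \<one>" if "\<psi> \<in> Irr G" "\<psi> \<noteq> \<chi>" for \<psi>
      using eq[OF that(1)] others_b[OF that] by simp
  qed
qed

text \<open>
  Both rows have the strictly largest degree, so they agree. Then the value at the element is
  determined as well, the two columns coincide, and the elements are conjugate.
\<close>
lemma exceptional_column_unique:
  assumes G2: "2 < Coset.order G" and ex: "exceptional_column G \<chi>' b'"
  shows "\<chi>' = \<chi>" "conj_class G b' = conj_class G b"
proof -
  interpret E: exceptional_column G \<chi>' b' by (rule ex)
  show eq: "\<chi>' = \<chi>"
  proof (rule ccontr)
    assume "\<chi>' \<noteq> \<chi>"
    then show False
      using degree_maximal[OF G2 E.chi_Irr] E.degree_maximal[OF G2 chi_Irr] by auto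
  qed
  have "\<chi> \<one> * (\<chi> \<one> - \<chi> b') = \<chi> \<one> * (\<chi> \<one> - \<chi> b)"
    using others_kernel_value[OF b_in_kernel b_neq_one] E.others_kernel_value[OF E.b_in_kernel E.b_neq_one] eq
    by simp
  then have "\<chi> b' = \<chi> b" using Irr_degree_nonzero[OF chi_Irr] by simp
  then have "\<psi> b' = \<psi> b" if "\<psi> \<in> Irr G" for \<psi>
    using others_b[OF that] E.others_b[OF that] eq by (cases "\<psi> = \<chi>") auto
  then show "conj_class G b' = conj_class G b"
    by (rule characters_separate_conj_classes[OF E.b_carrier b_carrier])
qed

lemma CD1_group_and_class:
  assumes G2: "2 < Coset.order G"
  shows "CD1_group G" "CD1_class G = conj_class G b"
proof -
  show "CD1_group G"
    unfolding CD1_group_def using is_group G2 columns_differ_once_one_b by auto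
  show "CD1_class G = conj_class G b"
    unfolding CD1_class_def
  proof (rule the_equality)
    show "\<exists>b'. columns_differ_once G \<one> b' \<and> conj_class G b = conj_class G b'"
      using columns_differ_once_one_b by blast
    fix C assume "\<exists>b'. columns_differ_once G \<one> b' \<and> C = conj_class G b'"
    then obtain b' where b': "columns_differ_once G \<one> b'" "C = conj_class G b'" by blast
    then obtain \<chi>' where "exceptional_column G \<chi>' b'"
      using exceptional_column_if_columns_differ by blast
    then show "C = conj_class G b" using exceptional_column_unique[OF G2] b'(2) by blast
  qed
qed

lemma value_eq_minus_degree_iff: "\<chi> b = - \<chi> \<one> \<longleftrightarrow> card others_kernel = 2"
proof
  assume "\<chi> b = - \<chi> \<one>"
  then have "(of_nat (card others_kernel) - 1) * \<chi> \<one> = 1 * \<chi> \<one>" using value_at_b by simp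
  then have "of_nat (card others_kernel) = (of_nat 2 :: complex)"
    using Irr_degree_nonzero[OF chi_Irr] by (simp add: field_simps)
  then show "card others_kernel = 2" using of_nat_eq_iff by blast
next
  assume "card others_kernel = 2"
  then show "\<chi> b = - \<chi> \<one>" using value_at_b by simp
qed

text \<open>
  The numbers \<open>card others_kernel - 1\<close> and \<open>card others_kernel\<close> are coprime; the first divides a
  power of the order of \<open>b\<close>, and the second is divisible by that order.
\<close>
lemma card_others_kernel_if_degree_power:
  assumes d: "\<chi> \<one> = of_nat (ord b ^ s)"
  shows "card others_kernel = 2"
proof -
  let ?c = "card others_kernel"
  have "(?c - 1) dvd (ord b ^ s)\<^sup>2 * ?c"
    using order_eq_degree[OF d] by (metis dvd_triv_right)
  moreover have cop: "coprime (?c - 1) ?c"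
    using card_others_kernel_ge_2 coprime_diff_one_left_nat[of ?c] by simp
  ultimately have "(?c - 1) dvd (ord b ^ s)\<^sup>2"
    by (simp add: coprime_dvd_mult_left_iff)
  moreover have "coprime (?c - 1) (ord b)"
  proof -
    interpret N: group "G\<lparr>carrier := others_kernel\<rparr>"
      by (rule subgroup_imp_group[OF subgroup_others_kernel])
    have "b [^]\<^bsub>G\<lparr>carrier := others_kernel\<rparr>\<^esub> ?c = \<one>"
      using N.pow_order_eq_1[of b] b_in_kernel by (simp add: Coset.order_def)
    then have "b [^] ?c = \<one>" using nat_pow_consistent by metis
    then have "ord b dvd ?c" using pow_eq_id[OF b_carrier] by blast
    then show ?thesis using cop by (meson coprime_divisors dvd_refl)
  qed
  ultimately have "?c - 1 = 1"
    by (metis coprime_absorb_left coprime_power_right_iff is_unit_power_iff nat_dvd_1_iff_1 power_mult)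
  then show ?thesis by simp
qed

lemma others_kernel_eq_center:
  assumes "card others_kernel = 2"
  shows "others_kernel = {\<one>, b}" "center G = {\<one>, b}"
proof -
  have "{\<one>, b} \<subseteq> others_kernel"
    using b_in_kernel subgroup.one_closed[OF subgroup_others_kernel] by simp
  then show N: "others_kernel = {\<one>, b}"
    using card_seteq[OF finite_others_kernel, of "{\<one>, b}"] assms b_neq_one by auto
  have "b \<otimes> g = g \<otimes> b" if g: "g \<in> carrier G" for g
  proof -
    have "g \<otimes> b \<otimes> inv g \<noteq> \<one>"
      using g b_carrier b_neq_one by (metis inv_equality inv_inv inv_closed m_closed l_cancel_one' r_inv_ex inv_solve_right)
    then have "g \<otimes> b \<otimes> inv g = b" using conjugate_in_others_kernel[OF g b_in_kernel] N by auto
    then show ?thesis using g b_carrier by (metis inv_solve_right m_closed)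
  qed
  then have "b \<in> center G" using b_carrier by (simp add: center_def)
  then show "center G = {\<one>, b}"
    using center_subset_others_kernel subgroup.one_closed[OF subgroup_center] N by auto
qed

lemma ord_b_eq_2:
  assumes c: "card others_kernel = 2"
  shows "ord b = 2"
proof -
  have "b \<otimes> b \<in> {\<one>, b}"
    using subgroup.m_closed[OF subgroup_others_kernel b_in_kernel b_in_kernel] others_kernel_eq_center(1)[OF c] by simp
  then have "b \<otimes> b = \<one>" using b_carrier b_neq_one by (metis empty_iff insert_iff l_cancel_one')
  then have "b [^] (2::nat) = \<one>" using b_carrier by (simp add: numeral_2_eq_2)
  then have "ord b dvd 2" using pow_eq_id[OF b_carrier] by blast
  moreover have "ord b \<noteq> 1" using ord_eq_1[OF b_carrier] b_neq_one by blast
  ultimately show ?thesis by (metis prime_nat_iff two_is_prime_nat)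
qed

text \<open>
  A Sylow subgroup \<open>H\<close> for an odd prime avoids \<open>b\<close>, so \<open>\<chi>\<close> vanishes on its nonidentity elements
  and \<open>card H\<close> divides the degree. Its square then divides the group order, which is twice the
  square of the degree.
\<close>
lemma order_power_of_two:
  assumes c: "card others_kernel = 2"
  shows "\<exists>m. Coset.order G = 2 ^ m"
proof (rule power_of_two_if_no_odd_prime_divisor)
  show "Coset.order G \<noteq> 0" using order_pos by simp
  fix p :: nat assume p: "Factorial_Ring.prime p" "p dvd Coset.order G"
  show "p = 2"
  proof (rule ccontr)
    assume p2: "p \<noteq> 2"
    obtain d where d: "\<chi> \<one> = of_nat d" using Irr_degree[OF chi_Irr] by blast
    have ord: "Coset.order G = 2 * d\<^sup>2" using order_eq_degree[OF d] c by simp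
    define a where "a = multiplicity p (Coset.order G)"
    obtain m where m: "Coset.order G = p ^ a * m" "\<not> p dvd m"
    proof -
      have "Coset.order G \<noteq> 0" and "\<not> p dvd 1" using order_pos p(1) by auto
      then show ?thesis using that multiplicity_decompose'[of "Coset.order G" p] unfolding a_def by metis
    qed
    obtain H where H: "subgroup H G" "card H = p ^ a"
      using sylow_thm[OF p(1) is_group m(1) finite_carrier] by blast
    have odd: "odd (p ^ a)" using p(1) p2 by (metis even_power primes_dvd_imp_eq two_is_prime_nat)
    have "b \<notin> H"
    proof
      assume "b \<in> H"
      interpret H: group "G\<lparr>carrier := H\<rparr>" by (rule subgroup_imp_group[OF H(1)])
      have "b [^]\<^bsub>G\<lparr>carrier := H\<rparr>\<^esub> card H = \<one>"
        using H.pow_order_eq_1[of b] \<open>b \<in> H\<close> by (simp add: Coset.order_def)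
      then have "b [^] card H = \<one>" using nat_pow_consistent by metis
      then have "2 dvd card H" using pow_eq_id[OF b_carrier] ord_b_eq_2[OF c] by metis
      then show False using odd H(2) by simp
    qed
    have one: "\<one> \<in> H" using subgroup.one_closed[OF H(1)] .
    have Hc: "H \<subseteq> carrier G" using subgroup.subset[OF H(1)] .
    have "(\<Sum>x\<in>H. \<chi> x) = \<chi> \<one> + (\<Sum>x\<in>H - {\<one>}. \<chi> x)"
      using sum.remove[OF finite_subset[OF Hc finite_carrier] one] .
    also have "(\<Sum>x\<in>H - {\<one>}. \<chi> x) = 0"
      using \<open>b \<notin> H\<close> Hc others_kernel_eq_center(1)[OF c] by (intro sum.neutral) (auto intro: vanishes_off_others_kernel)
    finally obtain k where "(of_nat d :: complex) = of_nat (k * p ^ a)"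
      using Irr_sum_over_subgroup[OF chi_Irr H(1)] H(2) d by auto
    then have "p ^ a dvd d" by (metis dvd_triv_right of_nat_eq_iff)
    then obtain e where "d = p ^ a * e" by blast
    then have "Coset.order G = p ^ a * (p ^ a * (2 * e\<^sup>2))"
      unfolding ord by (simp add: power2_eq_square mult.commute mult.left_commute)
    then have "p ^ a * m = p ^ a * (p ^ a * (2 * e\<^sup>2))" by (rule trans[OF m(1)[symmetric]])
    then have "m = p ^ a * (2 * e\<^sup>2)" using p(1) by (simp add: prime_gt_0_nat)
    moreover have "a > 0" unfolding a_def using p order_pos by (simp add: prime_multiplicity_gt_zero_iff)
    ultimately show False using m(2) by (metis dvd_mult2 dvd_power)
  qed
qed

lemma degree_power_of_ord:
  assumes c: "card others_kernel = 2" and G2: "2 < Coset.order G"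
  shows "\<exists>s>0. \<chi> \<one> = of_nat (ord b ^ s)"
proof -
  obtain d where d: "\<chi> \<one> = of_nat d" using Irr_degree[OF chi_Irr] by blast
  have ord: "Coset.order G = 2 * d\<^sup>2" using order_eq_degree[OF d] c by simp
  obtain m where m: "Coset.order G = 2 ^ m" using order_power_of_two[OF c] by blast
  have "d dvd 2 ^ m" using ord m by (metis dvd_mult dvd_triv_left power2_eq_square)
  then obtain s where s: "d = 2 ^ s" using divides_primepow_nat[OF two_is_prime_nat] by blast
  have "s > 0" using s ord G2 by (cases s) auto
  then show ?thesis using d s ord_b_eq_2[OF c] by auto
qed

lemma central_type_if_card_2:
  assumes c: "card others_kernel = 2"
  shows "central_type G" "card (center G) = 2"
proof -
  obtain d where d: "\<chi> \<one> = of_nat d" using Irr_degree[OF chi_Irr] by blast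
  have ord: "Coset.order G = 2 * d\<^sup>2" using order_eq_degree[OF d] c by simp
  show z2: "card (center G) = 2" using others_kernel_eq_center[OF c] c by simp
  have "card (rcosets (center G)) = d\<^sup>2"
    using lagrange[OF subgroup_center] z2 ord by simp
  then show "central_type G"
    unfolding central_type_def using chi_Irr d by (intro bexI[of _ \<chi>]) auto
qed

end

section \<open>Groups of central type and the equivalence\<close>

context finite_group
begin

text \<open>
  A central involution \<open>z\<close> has the value plus or minus the degree under every irreducible
  character, and the squares of the degrees of either sign sum to half the group order.
\<close>
lemma central_type_exceptional:
  assumes G2: "2 < Coset.order G" and ct: "central_type G" and z2: "card (center G) = 2"
  shows "\<exists>\<psi> z. exceptional_column G \<psi> z \<and> center G = {\<one>, z} \<and> \<psi> z = - \<psi> \<one>"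
proof -
  have "\<one> \<in> center G" by (rule subgroup.one_closed[OF subgroup_center])
  then obtain z where z: "center G = {\<one>, z}" "z \<noteq> \<one>"
    using z2 by (metis card_2_iff doubleton_eq_iff insertE singletonD)
  have zcen: "z \<in> center G" and zc: "z \<in> carrier G" using z by (auto simp: center_def)
  have "z \<otimes> z \<in> {\<one>, z}" using subgroup.m_closed[OF subgroup_center zcen zcen] z by simp
  then have zz: "z \<otimes> z = \<one>" using zc z(2) by (metis empty_iff insert_iff l_cancel_one')
  have sign: "\<phi> z = \<phi> \<one> \<or> \<phi> z = - \<phi> \<one>" if \<phi>: "\<phi> \<in> Irr G" for \<phi>
  proof -
    obtain c where c: "\<And>g. g \<in> carrier G \<Longrightarrow> \<phi> (z \<otimes> g) = c * \<phi> g"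
      using Irr_scalar_on_center[OF \<phi> zcen] by metis
    have "\<phi> z = c * \<phi> \<one>" using c[of \<one>] zc by simp
    moreover have "\<phi> \<one> = c * \<phi> z" using c[OF zc] zz by simp
    ultimately have "c * c = 1" using Irr_degree_nonzero[OF \<phi>] by (simp add: mult.assoc[symmetric])
    then have "c = 1 \<or> c = -1" by (metis square_eq_1_iff)
    then show ?thesis using \<open>\<phi> z = c * \<phi> \<one>\<close> by auto
  qed
  obtain \<psi> where \<psi>: "\<psi> \<in> Irr G" "of_nat (card (rcosets (center G))) = (\<psi> \<one>)\<^sup>2"
    using ct by (auto simp: central_type_def)
  have ord: "2 * (\<psi> \<one> * \<psi> \<one>) = of_nat (Coset.order G)"
    using \<psi>(2) lagrange[OF subgroup_center] z2 by (metis mult.commute of_nat_mult of_nat_numeral power2_eq_square)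
  have zero: "(\<Sum>\<phi>\<in>Irr G. \<phi> \<one> * \<phi> z) = 0" using regular_character_identity[OF zc] z(2) by simp
  \<comment> \<open>One of the two halves of the square sum is exhausted by \<open>\<psi>\<close>.\<close>
  have only: "\<phi> z = - (\<epsilon> * \<phi> \<one>)"
    if \<epsilon>: "\<epsilon> = 1 \<or> \<epsilon> = -1" and eps: "\<psi> z = \<epsilon> * \<psi> \<one>" and \<phi>: "\<phi> \<in> Irr G" "\<phi> \<noteq> \<psi>" for \<phi> \<epsilon>
  proof -
    have "of_nat (Coset.order G) = (\<Sum>\<phi>\<in>Irr G. \<phi> \<one> * \<phi> \<one>) + \<epsilon> * (\<Sum>\<phi>\<in>Irr G. \<phi> \<one> * \<phi> z)"
      using zero Irr_degree_square_sum by simp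
    also have "\<dots> = (\<Sum>\<phi>\<in>Irr G. \<phi> \<one> * (\<phi> \<one> + \<epsilon> * \<phi> z))"
      by (simp add: sum.distrib sum_distrib_left algebra_simps)
    also have "\<dots> = \<psi> \<one> * (\<psi> \<one> + \<epsilon> * \<psi> z) + (\<Sum>\<phi>\<in>Irr G - {\<psi>}. \<phi> \<one> * (\<phi> \<one> + \<epsilon> * \<phi> z))"
      by (rule sum.remove[OF finite_Irr \<psi>(1)])
    also have "\<psi> \<one> * (\<psi> \<one> + \<epsilon> * \<psi> z) = of_nat (Coset.order G)"
      using eps \<epsilon> ord by (auto simp: algebra_simps)
    finally have "(\<Sum>\<phi>\<in>Irr G - {\<psi>}. \<phi> \<one> * (\<phi> \<one> + \<epsilon> * \<phi> z)) = 0" by simp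
    then have "(\<Sum>\<phi>\<in>Irr G - {\<psi>}. Re (\<phi> \<one> * (\<phi> \<one> + \<epsilon> * \<phi> z))) = 0"
      by (metis Re_sum zero_complex.sel(1))
    moreover have "Re (\<phi> \<one> * (\<phi> \<one> + \<epsilon> * \<phi> z)) \<ge> 0" if "\<phi> \<in> Irr G" for \<phi>
      using Irr_degree[OF that] sign[OF that] \<epsilon> by auto
    ultimately have 0: "Re (\<phi> \<one> * (\<phi> \<one> + \<epsilon> * \<phi> z)) = 0"
      using \<phi> by (subst (asm) sum_nonneg_eq_0_iff) auto
    obtain d where d: "0 < d" "\<phi> \<one> = of_nat d" using Irr_degree[OF \<phi>(1)] by blast
    show ?thesis using 0 d sign[OF \<phi>(1)] \<epsilon> by auto
  qed
  have neg: "\<psi> z = - \<psi> \<one>"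
  proof (rule ccontr)
    assume "\<psi> z \<noteq> - \<psi> \<one>"
    then have pos: "\<psi> z = 1 * \<psi> \<one>" using sign[OF \<psi>(1)] by auto
    have "\<psi> = principal_character G"
    proof (rule ccontr)
      assume "\<psi> \<noteq> principal_character G"
      then have "principal_character G z = - (1 * principal_character G \<one>)"
        using only[OF _ pos principal_character_in_Irr] by auto
      then show False using zc by (simp add: principal_character_def)
    qed
    then have "(2::complex) = of_nat (Coset.order G)" using ord by (simp add: principal_character_def)
    then have "Coset.order G = 2" by (metis of_nat_eq_iff of_nat_numeral)
    then show False using G2 by simp
  qed
  then have "\<psi> z = -1 * \<psi> \<one>" by simp
  then have others: "\<phi> z = \<phi> \<one>" if "\<phi> \<in> Irr G" "\<phi> \<noteq> \<psi>" for \<phi> using only[OF _ _ that, of "-1"] by simp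
  have "\<psi> z \<noteq> \<psi> \<one>" using neg Irr_degree_nonzero[OF \<psi>(1)] by (auto simp: eq_neg_iff_add_eq_0 minus_equation_iff)
  then have "exceptional_column G \<psi> z"
    using \<psi>(1) zc others by unfold_locales auto
  then show ?thesis using z neg by blast
qed

text \<open>
  The class is a definite description, so the uniqueness of the exceptional column is needed
  already to know that \<open>b\<close> has such a column.
\<close>
lemma CD1_class_exceptional:
  assumes CD1: "CD1_group G" and b: "b \<in> CD1_class G"
  shows "\<exists>\<psi>. exceptional_column G \<psi> b"
proof -
  obtain x y where xy: "columns_differ_once G x y" using CD1 by (auto simp: CD1_group_def)
  have G2: "2 < Coset.order G" using CD1 by (simp add: CD1_group_def)
  obtain b0 where "columns_differ_once G \<one> b0"
    using columns_differ_once_imp_one[OF xy] xy columns_differ_once_sym[OF xy] by auto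
  then obtain \<psi> where "exceptional_column G \<psi> b0"
    using exceptional_column_if_columns_differ by blast
  then interpret exceptional_column G \<psi> b0 .
  have "b \<in> conj_class G b0" using b CD1_group_and_class(2)[OF G2] by simp
  then show ?thesis using exceptional_column_conjugate by blast
qed

end

theorem proposition3p2:
  fixes G :: "('a, 'm) monoid_scheme"
    and k :: nat
    and \<chi> :: "nat \<Rightarrow> 'a \<Rightarrow> complex"
    and b :: 'a
  assumes "group G"
    and "finite (carrier G)"
    and "Coset.order G > 2"
    and "irr_enumeration G k \<chi>"
    and "CD1_group G \<Longrightarrow> b \<in> CD1_class G"
  shows "(CD1_group G \<and> \<chi> k b = - \<chi> k \<one>\<^bsub>G\<^esub>
          \<longleftrightarrow> CD1_group G \<and> (\<exists>s::nat. s > 0 \<and> \<chi> k \<one>\<^bsub>G\<^esub> = of_nat (group.ord G b ^ s)))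
       \<and> (CD1_group G \<and> (\<exists>s::nat. s > 0 \<and> \<chi> k \<one>\<^bsub>G\<^esub> = of_nat (group.ord G b ^ s))
          \<longleftrightarrow> two_group G \<and> central_type G \<and> card (center G) = 2)
       \<and> (two_group G \<and> central_type G \<and> card (center G) = 2
          \<longrightarrow> center G = {\<one>\<^bsub>G\<^esub>} \<union> conj_class G b)"
proof -
  interpret group G by (rule assms(1))
  interpret finite_group G by unfold_locales (rule assms(2))
  note G2 = assms(3)
  \<comment> \<open>The enumeration is ascending, so the unique character of maximal degree comes last.\<close>
  have last: "\<chi> k = \<psi>" if "exceptional_column G \<psi> b'" for \<psi> b'
  proof (rule ccontr)
    assume ne: "\<chi> k \<noteq> \<psi>"
    interpret exceptional_column G \<psi> b' by (rule that)
    have bij: "bij_betw \<chi> {1..k} (Irr G)"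
      and mono: "\<And>i j. 1 \<le> i \<Longrightarrow> i \<le> j \<Longrightarrow> j \<le> k \<Longrightarrow> Re (\<chi> i \<one>\<^bsub>G\<^esub>) \<le> Re (\<chi> j \<one>\<^bsub>G\<^esub>)"
      using assms(4) by (auto simp: irr_enumeration_def)
    obtain j where j: "j \<in> {1..k}" "\<psi> = \<chi> j" using bij chi_Irr by (metis bij_betw_imp_surj_on imageE)
    have "\<chi> k \<in> Irr G" using bij j(1) by (auto simp: bij_betw_def)
    then show False using degree_maximal[OF G2 _ ne] mono[of j k] j by auto
  qed
  have if_CD1: "(\<chi> k b = - \<chi> k \<one>\<^bsub>G\<^esub> \<longleftrightarrow> (\<exists>s::nat. s > 0 \<and> \<chi> k \<one>\<^bsub>G\<^esub> = of_nat (group.ord G b ^ s)))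
      \<and> (\<chi> k b = - \<chi> k \<one>\<^bsub>G\<^esub> \<longrightarrow> two_group G \<and> central_type G \<and> card (center G) = 2)"
    if CD1: "CD1_group G"
  proof -
    obtain \<psi> where ex: "exceptional_column G \<psi> b" using CD1_class_exceptional[OF CD1 assms(5)[OF CD1]] by blast
    interpret exceptional_column G \<psi> b by (rule ex)
    show ?thesis
      unfolding last[OF ex] value_eq_minus_degree_iff two_group_def
      using card_others_kernel_if_degree_power degree_power_of_ord[OF _ G2] order_power_of_two central_type_if_card_2
      by blast
  qed
  have if_central_type: "CD1_group G \<and> \<chi> k b = - \<chi> k \<one>\<^bsub>G\<^esub> \<and> center G = {\<one>\<^bsub>G\<^esub>} \<union> conj_class G b"
    if 3: "central_type G" "card (center G) = 2"
  proof -
    obtain \<psi> z where ex: "exceptional_column G \<psi> z" and z: "center G = {\<one>\<^bsub>G\<^esub>, z}" "\<psi> z = - \<psi> \<one>\<^bsub>G\<^esub>"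
      using central_type_exceptional[OF G2 3] by blast
    interpret exceptional_column G \<psi> z by (rule ex)
    have "conj_class G z = {z}" by (rule conj_class_central) (simp add: z)
    moreover have "b \<in> conj_class G z" using assms(5) CD1_group_and_class[OF G2] by simp
    ultimately show ?thesis using last[OF ex] z CD1_group_and_class[OF G2] by auto
  qed
  show ?thesis using if_CD1 if_central_type by blast
qed

end
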